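(* Let $M$ and $M'$ be Coxeter matrices over finite sets $I$ and $I'$, and let $\phi:(W(M'),\star)\to(W(M),\star)$ be a light homomorphism of Hecke monoids. Then $\phi$ maps all parabolic elements to parabolic elements; that is, for every $K'\subset I'$ such that $W_{K'}(M')$ is finite and every $J'\subset K'$ there exist $K\subset I$ with $W_K(M)$ finite and $J\subset K$ such that $\phi(w_{J';K'})=w_{J;K}$.
   Context: A Coxeter matrix over a finite set $I$ is a symmetric matrix $M=(m_{ij})_{i,j\in I}$ with $m_{ii}=1$ and $m_{ij}\in\mathbb Z_{\ge 2}\cup\{\infty\}$ for $i\ne j$. $W(M)$ is the corresponding Coxeter group with simple generators $s_i$, $i\in I$, and length function $\ell$. The Hecke monoid $(W(M),\star)$ is the monoid generated by $s_i$, $i\in I$, subject to $s_i\star s_i=s_i$ and $s_i\star s_j\star s_i\star\cdots=s_j\star s_i\star s_j\star\cdots$ ($m_{ij}$ factors on each side) for $i\neq j$ with $m_{ij}<\infty$; as a set it is identified with $W(M)$, the product being determined by $s_i\star w=s_iw$ if $\ell(s_iw)>\ell(w)$ and $s_i\star w=w$ otherwise. Homomorphisms of monoids map the identity to the identity. For $K\subset I$, $W_K(M)=\langle s_k: k\in K\rangle$ (parabolic subgroup). If $W_K(M)$ is finite, $w_\circ^K$ denotes its longest element. For $J\subset K$ with $W_K(M)$ finite put $w_{J;K}=w_\circ^Jw_\circ^K$ (product in the group $W(M)$); such elements are called parabolic. A homomorphism $\phi:(W(M'),\star)\to(W(M),\star)$ is called light if for every $i\in I'$ the image of the generator $s'_i$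 is either a generator $s_j$, $j\in I$, or $1$. *)

theory Defs
  imports "HOL-Algebra.Generated_Groups" "HOL-Library.Extended_Nat"
begin

section \<open>Monoids given by generators and relations\<close>

inductive_set word_cong :: "'a set \<Rightarrow> ('a list \<times> 'a list) set \<Rightarrow> ('a list \<times> 'a list) set"
  for S :: "'a set" and R :: "('a list \<times> 'a list) set" where
  rel: "(xs, ys) \<in> R \<Longrightarrow> (xs, ys) \<in> word_cong S R"
| refl: "xs \<in> lists S \<Longrightarrow> (xs, xs) \<in> word_cong S R"
| sym: "(xs, ys) \<in> word_cong S R \<Longrightarrow> (ys, xs) \<in> word_cong S R"
| trans: "(xs, ys) \<in> word_cong S R \<Longrightarrow> (ys, zs) \<in> word_cong S R \<Longrightarrow> (xs, zs) \<in> word_cong S R"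
| append: "(xs, ys) \<in> word_cong S R \<Longrightarrow> (us, vs) \<in> word_cong S R \<Longrightarrow>
    (xs @ us, ys @ vs) \<in> word_cong S R"

definition presented_monoid :: "'a set \<Rightarrow> ('a list \<times> 'a list) set \<Rightarrow> 'a list set monoid" where
  "presented_monoid S R =
    \<lparr>carrier = lists S // word_cong S R,
     mult = (\<lambda>A B. \<Union>xs\<in>A. \<Union>ys\<in>B. word_cong S R `` {xs @ ys}),
     one = word_cong S R `` {[]}\<rparr>"

lemma word_cong_in_lists:
  assumes "R \<subseteq> lists S \<times> lists S" and "(xs, ys) \<in> word_cong S R"
  shows "xs \<in> lists S \<and> ys \<in> lists S"
  using assms(2) by (induction rule: word_cong.induct) (use assms(1) in auto)

lemma equiv_word_cong:
  assumes "R \<subseteq> lists S \<times> lists S"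
  shows "equiv (lists S) (word_cong S R)"
proof (rule equivI)
  show "word_cong S R \<subseteq> lists S \<times> lists S"
    using word_cong_in_lists[OF assms] by auto
  show "refl_on (lists S) (word_cong S R)"
    by (rule refl_onI) (rule word_cong.refl)
  show "sym (word_cong S R)" by (rule symI) (rule word_cong.sym)
  show "trans (word_cong S R)" by (rule transI) (rule word_cong.trans)
qed

lemma presented_monoid_mult:
  assumes R: "R \<subseteq> lists S \<times> lists S" and "xs \<in> lists S" "ys \<in> lists S"
  shows "word_cong S R `` {xs} \<otimes>\<^bsub>presented_monoid S R\<^esub> word_cong S R `` {ys}
    = word_cong S R `` {xs @ ys}"
proof -
  have "word_cong S R `` {us @ vs} = word_cong S R `` {xs @ ys}"
    if "(xs, us) \<in> word_cong S R" "(ys, vs) \<in> word_cong S R" for us vs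
    using equiv_class_eq[OF equiv_word_cong[OF R] word_cong.append[OF that]] by simp
  then have "(\<Union>us\<in>word_cong S R `` {xs}. \<Union>vs\<in>word_cong S R `` {ys}.
      word_cong S R `` {us @ vs}) =
    (\<Union>us\<in>word_cong S R `` {xs}. \<Union>vs\<in>word_cong S R `` {ys}. word_cong S R `` {xs @ ys})"
    by (intro SUP_cong HOL.refl) simp_all
  moreover have "word_cong S R `` {xs} \<noteq> {}" "word_cong S R `` {ys} \<noteq> {}"
    using word_cong.refl[of xs S R] word_cong.refl[of ys S R] assms(2,3) by blast+
  ultimately show ?thesis
    by (simp add: presented_monoid_def)
qed

lemma presented_monoid_carrierE:
  assumes "A \<in> carrier (presented_monoid S R)"
  obtains xs where "xs \<in> lists S" and "A = word_cong S R `` {xs}"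
proof -
  have "A \<in> lists S // word_cong S R"
    using assms by (simp add: presented_monoid_def)
  then show ?thesis by (rule quotientE) (rule that)
qed

lemma presented_monoid_carrierI:
  "xs \<in> lists S \<Longrightarrow> word_cong S R `` {xs} \<in> carrier (presented_monoid S R)"
  unfolding presented_monoid_def by (simp add: quotientI)

lemma presented_monoid_one: "\<one>\<^bsub>presented_monoid S R\<^esub> = word_cong S R `` {[]}"
  by (simp add: presented_monoid_def)

lemma monoid_presented_monoid:
  assumes R: "R \<subseteq> lists S \<times> lists S"
  shows "monoid (presented_monoid S R)"
proof (rule monoidI)
  show "\<one>\<^bsub>presented_monoid S R\<^esub> \<in> carrier (presented_monoid S R)"
    by (simp only: presented_monoid_one) (rule presented_monoid_carrierI, simp)
next
  fix A B
  assume "A \<in> carrier (presented_monoid S R)" "B \<in> carrier (presented_monoid S R)"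
  then obtain xs ys where
    "xs \<in> lists S" "A = word_cong S R `` {xs}" "ys \<in> lists S" "B = word_cong S R `` {ys}"
    by (metis presented_monoid_carrierE)
  then show "A \<otimes>\<^bsub>presented_monoid S R\<^esub> B \<in> carrier (presented_monoid S R)"
    by (metis R append_in_lists_conv presented_monoid_carrierI presented_monoid_mult)
next
  fix A B C
  assume "A \<in> carrier (presented_monoid S R)" "B \<in> carrier (presented_monoid S R)"
    "C \<in> carrier (presented_monoid S R)"
  then obtain xs ys zs where
    "xs \<in> lists S" "A = word_cong S R `` {xs}" "ys \<in> lists S" "B = word_cong S R `` {ys}"
    "zs \<in> lists S" "C = word_cong S R `` {zs}"
    by (metis presented_monoid_carrierE)
  then show "A \<otimes>\<^bsub>presented_monoid S R\<^esub> B \<otimes>\<^bsub>presented_monoid S R\<^esub> C =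
    A \<otimes>\<^bsub>presented_monoid S R\<^esub> (B \<otimes>\<^bsub>presented_monoid S R\<^esub> C)"
    by (simp add: presented_monoid_mult[OF R] del: Image_singleton_iff)
next
  fix A
  assume "A \<in> carrier (presented_monoid S R)"
  then obtain xs where xs: "xs \<in> lists S" "A = word_cong S R `` {xs}"
    by (metis presented_monoid_carrierE)
  show "\<one>\<^bsub>presented_monoid S R\<^esub> \<otimes>\<^bsub>presented_monoid S R\<^esub> A = A"
    using presented_monoid_mult[OF R, of "[]" xs] xs by (simp add: presented_monoid_one)
  show "A \<otimes>\<^bsub>presented_monoid S R\<^esub> \<one>\<^bsub>presented_monoid S R\<^esub> = A"
    using presented_monoid_mult[OF R, of xs "[]"] xs by (simp add: presented_monoid_one)
qed


section \<open>Coxeter groups\<close>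

definition coxeter_matrix :: "'i set \<Rightarrow> ('i \<Rightarrow> 'i \<Rightarrow> enat) \<Rightarrow> bool" where
  "coxeter_matrix I M \<longleftrightarrow> finite I \<and> (\<forall>i\<in>I. M i i = 1) \<and>
    (\<forall>i\<in>I. \<forall>j\<in>I. M i j = M j i \<and> (i \<noteq> j \<longrightarrow> 2 \<le> M i j))"

text \<open>The relations are \<open>(s\<^sub>i s\<^sub>j)\<^bsup>m\<^esup> = 1\<close> with \<open>m = m\<^sub>i\<^sub>j\<close> finite. Since \<open>m\<^sub>i\<^sub>i = 1\<close>, the case
  \<open>i = j\<close> reads \<open>s\<^sub>i s\<^sub>i = 1\<close>; so every generator is its own inverse, and the monoid with this
  presentation is the group with this presentation.\<close>

definition coxeter_rels :: "'i set \<Rightarrow> ('i \<Rightarrow> 'i \<Rightarrow> enat) \<Rightarrow> ('i list \<times> 'i list) set" where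
  "coxeter_rels I M =
    {(concat (replicate m [i, j]), []) | i j m. i \<in> I \<and> j \<in> I \<and> M i j = enat m}"

definition coxeter_group :: "'i set \<Rightarrow> ('i \<Rightarrow> 'i \<Rightarrow> enat) \<Rightarrow> 'i list set monoid" where
  "coxeter_group I M = presented_monoid I (coxeter_rels I M)"

definition cox_elt :: "'i set \<Rightarrow> ('i \<Rightarrow> 'i \<Rightarrow> enat) \<Rightarrow> 'i list \<Rightarrow> 'i list set" where
  "cox_elt I M xs = word_cong I (coxeter_rels I M) `` {xs}"

lemma coxeter_rels_lists: "coxeter_rels I M \<subseteq> lists I \<times> lists I"
  unfolding coxeter_rels_def by (auto split: if_splits)

lemma group_coxeter_group:
  assumes "coxeter_matrix I M"
  shows "group (coxeter_group I M)"
proof -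
  let ?R = "coxeter_rels I M"
  interpret monoid "coxeter_group I M"
    unfolding coxeter_group_def by (rule monoid_presented_monoid[OF coxeter_rels_lists])
  have inv: "(rev xs @ xs, []) \<in> word_cong I ?R" if "xs \<in> lists I" for xs
    using that
  proof (induction xs)
    case Nil
    show ?case by (simp add: word_cong.refl)
  next
    case (Cons x xs)
    have "M x x = enat 1" using assms Cons.hyps by (simp add: coxeter_matrix_def one_enat_def)
    then have "(concat (replicate 1 [x, x]), []) \<in> ?R"
      unfolding coxeter_rels_def using Cons.hyps by blast
    then have "([x, x], []) \<in> word_cong I ?R" using word_cong.rel by fastforce
    moreover have "(rev xs, rev xs) \<in> word_cong I ?R" "(xs, xs) \<in> word_cong I ?R"
      using Cons.hyps by (auto intro: word_cong.refl)
    ultimately have "(rev xs @ [x, x] @ xs, rev xs @ [] @ xs) \<in> word_cong I ?R"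
      by (intro word_cong.append)
    then show ?case using Cons.IH word_cong.trans by fastforce
  qed
  show ?thesis
  proof (rule group_l_invI)
    fix A
    assume "A \<in> carrier (coxeter_group I M)"
    then obtain xs where xs: "xs \<in> lists I" "A = word_cong I ?R `` {xs}"
      unfolding coxeter_group_def by (metis presented_monoid_carrierE)
    have "word_cong I ?R `` {rev xs @ xs} = word_cong I ?R `` {[]}"
      using equiv_class_eq[OF equiv_word_cong[OF coxeter_rels_lists] inv[OF xs(1)]] .
    moreover have "rev xs \<in> lists I" using xs(1) by auto
    ultimately show "\<exists>B\<in>carrier (coxeter_group I M).
        B \<otimes>\<^bsub>coxeter_group I M\<^esub> A = \<one>\<^bsub>coxeter_group I M\<^esub>"
      using xs unfolding coxeter_group_def
      by (metis coxeter_rels_lists presented_monoid_carrierI presented_monoid_mult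
          presented_monoid_one)
  qed
qed

definition cox_length :: "'i set \<Rightarrow> ('i \<Rightarrow> 'i \<Rightarrow> enat) \<Rightarrow> 'i list set \<Rightarrow> nat" where
  "cox_length I M w = (LEAST n. \<exists>xs\<in>lists I. length xs = n \<and> cox_elt I M xs = w)"

definition parabolic_subgroup :: "'i set \<Rightarrow> ('i \<Rightarrow> 'i \<Rightarrow> enat) \<Rightarrow> 'i set \<Rightarrow> 'i list set set" where
  "parabolic_subgroup I M K = generate (coxeter_group I M) ((\<lambda>k. cox_elt I M [k]) ` K)"

text \<open>Meaningful only if the parabolic subgroup is finite; the element of maximal length is
  then unique.\<close>

definition longest_elt :: "'i set \<Rightarrow> ('i \<Rightarrow> 'i \<Rightarrow> enat) \<Rightarrow> 'i set \<Rightarrow> 'i list set" where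
  "longest_elt I M K = (ARG_MAX (cox_length I M) w. w \<in> parabolic_subgroup I M K)"

definition parabolic_elt :: "'i set \<Rightarrow> ('i \<Rightarrow> 'i \<Rightarrow> enat) \<Rightarrow> 'i set \<Rightarrow> 'i set \<Rightarrow> 'i list set" where
  "parabolic_elt I M J K = longest_elt I M J \<otimes>\<^bsub>coxeter_group I M\<^esub> longest_elt I M K"


section \<open>Hecke monoids\<close>

fun alt_word :: "nat \<Rightarrow> 'i \<Rightarrow> 'i \<Rightarrow> 'i list" where
  "alt_word 0 i j = []"
| "alt_word (Suc n) i j = i # alt_word n j i"

definition hecke_rels :: "'i set \<Rightarrow> ('i \<Rightarrow> 'i \<Rightarrow> enat) \<Rightarrow> ('i list \<times> 'i list) set" where
  "hecke_rels I M = {([i, i], [i]) | i. i \<in> I} \<union>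
    {(alt_word m i j, alt_word m j i) | i j m. i \<in> I \<and> j \<in> I \<and> i \<noteq> j \<and> M i j = enat m}"

definition hecke_monoid :: "'i set \<Rightarrow> ('i \<Rightarrow> 'i \<Rightarrow> enat) \<Rightarrow> 'i list set monoid" where
  "hecke_monoid I M = presented_monoid I (hecke_rels I M)"

definition hecke_elt :: "'i set \<Rightarrow> ('i \<Rightarrow> 'i \<Rightarrow> enat) \<Rightarrow> 'i list \<Rightarrow> 'i list set" where
  "hecke_elt I M xs = word_cong I (hecke_rels I M) `` {xs}"

lemma set_alt_word: "set (alt_word n i j) \<subseteq> {i, j}"
  by (induction n arbitrary: i j) auto

lemma monoid_hecke_monoid: "monoid (hecke_monoid I M)"
proof -
  have "alt_word n i j \<in> lists I" if "i \<in> I" "j \<in> I" for n i j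
    using set_alt_word[of n i j] that by auto
  then have "hecke_rels I M \<subseteq> lists I \<times> lists I"
    unfolding hecke_rels_def by (fastforce simp del: in_lists_conv_set)
  then show ?thesis
    unfolding hecke_monoid_def by (rule monoid_presented_monoid)
qed

definition reduced_word :: "'i set \<Rightarrow> ('i \<Rightarrow> 'i \<Rightarrow> enat) \<Rightarrow> 'i list set \<Rightarrow> 'i list \<Rightarrow> bool" where
  "reduced_word I M w xs \<longleftrightarrow>
    xs \<in> lists I \<and> cox_elt I M xs = w \<and> length xs = cox_length I M w"

text \<open>The identification of the set \<open>W(M)\<close> with the Hecke monoid: if
  \<open>w = s\<^sub>1 \<dots> s\<^sub>n\<close> is a reduced expression, then \<open>w\<close> corresponds to \<open>s\<^sub>1 \<star> \<dots> \<star> s\<^sub>n\<close>.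
  Any two reduced expressions of \<open>w\<close> are related by braid relations (Matsumoto), so
  the choice of the expression is immaterial. Under this bijection \<open>s\<^sub>i \<star> w = s\<^sub>i w\<close> if
  \<open>s\<^sub>i w\<close> is longer than \<open>w\<close>, and \<open>s\<^sub>i \<star> w = w\<close> otherwise.\<close>

definition cox_to_hecke :: "'i set \<Rightarrow> ('i \<Rightarrow> 'i \<Rightarrow> enat) \<Rightarrow> 'i list set \<Rightarrow> 'i list set" where
  "cox_to_hecke I M w = hecke_elt I M (SOME xs. reduced_word I M w xs)"

text \<open>In HOL-Algebra, \<open>hom\<close> does not require the unit to be preserved.\<close>

definition light_hom :: "'i set \<Rightarrow> ('i \<Rightarrow> 'i \<Rightarrow> enat) \<Rightarrow> 'j set \<Rightarrow> ('j \<Rightarrow> 'j \<Rightarrow> enat) \<Rightarrow>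
    ('i list set \<Rightarrow> 'j list set) \<Rightarrow> bool" where
  "light_hom I' M' I M \<phi> \<longleftrightarrow>
    \<phi> \<in> hom (hecke_monoid I' M') (hecke_monoid I M) \<and>
    \<phi> \<one>\<^bsub>hecke_monoid I' M'\<^esub> = \<one>\<^bsub>hecke_monoid I M\<^esub> \<and>
    (\<forall>i\<in>I'. (\<exists>j\<in>I. \<phi> (hecke_elt I' M' [i]) = hecke_elt I M [j]) \<or>
      \<phi> (hecke_elt I' M' [i]) = \<one>\<^bsub>hecke_monoid I M\<^esub>)"

end

theory Submission
  imports Defs Complex_Main
begin

text \<open>Conjugation by the longest element of a finite parabolic subgroup permutes its generators.
  Hence, for \<open>w = w\<^bsub>J;K\<^esub>\<close> and every \<open>k \<in> K\<close>, either \<open>s\<^sub>k \<star> w = w\<close> or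
  \<open>s\<^sub>k \<star> w = w \<star> s\<^sub>l\<close> for some \<open>l \<in> K\<close>. A light homomorphism preserves this property, and it
  characterizes parabolic elements: if \<open>x\<close> has it and \<open>J\<close> is the set of \<open>k \<in> K\<close> that are not left
  descents of \<open>x\<close>, then \<open>w\<^sub>J \<star> x = x \<star> v\<close> for some \<open>v\<close> in the submonoid generated by \<open>K\<close>,
  where \<open>w\<^sub>J\<close> is the longest element for \<open>J\<close>. The left-hand side absorbs \<open>s\<^sub>k\<close> for \<open>k \<in> J\<close>, the
  right-hand side for \<open>k \<in> K - J\<close>; so both are the longest element for \<open>K\<close>, and
  \<open>x = w\<^bsub>J;K\<^esub>\<close>. Finiteness for the target follows as the image of a longest element
  absorbs all generators.

  Computing in the Hecke monoid with reduced words rests on Matsumoto's theorem, for which the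
  exchange condition is derived from the parity of reflection multiplicities, and the exact orders
  of the products of two generators from the geometric representation.\<close>


section \<open>Words and the exchange condition\<close>

lemma length_alt_word [simp]: "length (alt_word n i j) = n"
  by (induction n arbitrary: i j) auto

lemma alt_word_add:
  "alt_word (a + b) i j = alt_word a i j @ (if even a then alt_word b i j else alt_word b j i)"
  by (induction a arbitrary: i j) auto

lemma alt_word_Suc_right: "alt_word (Suc n) i j = alt_word n i j @ [if even n then i else j]"
  using alt_word_add[of n 1 i j] by simp

lemma rev_alt_word: "rev (alt_word n i j) = (if even n then alt_word n j i else alt_word n i j)"
proof (induction n arbitrary: i j)
  case (Suc n)
  show ?case
    by (subst alt_word_Suc_right) (simp add: Suc)
qed simp

lemma alt_word_double: "alt_word (2 * n) i j = alt_word n i j @ rev (alt_word n j i)"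
  using alt_word_add[of n n i j] by (simp add: rev_alt_word mult_2)

lemma concat_replicate_alt_word: "concat (replicate m [i, j]) = alt_word (2 * m) i j"
  by (induction m) simp_all

lemma alt_word_subset: "i \<in> I \<Longrightarrow> j \<in> I \<Longrightarrow> set (alt_word n i j) \<subseteq> I"
  using set_alt_word[of n i j] by auto

lemma hecke_rels_lists: "hecke_rels I M \<subseteq> lists I \<times> lists I"
proof
  fix p
  assume "p \<in> hecke_rels I M"
  then show "p \<in> lists I \<times> lists I"
    unfolding hecke_rels_def using alt_word_subset[of _ I] by fastforce
qed

section \<open>Words as representatives of elements of a Coxeter group\<close>

locale coxeter =
  fixes I :: "'i set" and M :: "'i \<Rightarrow> 'i \<Rightarrow> enat"
  assumes matrix: "coxeter_matrix I M"
begin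

abbreviation elt :: "'i list \<Rightarrow> 'i list set" where
  "elt \<equiv> cox_elt I M"

abbreviation hk :: "'i list \<Rightarrow> 'i list set" where
  "hk \<equiv> hecke_elt I M"

text \<open>Group elements are handled through representing words: \<open>len\<close> is the length
  of the element, \<open>length\<close> that of the word, and \<open>desc\<close> below is the left
  descent relation of the element.\<close>

definition len :: "'i list \<Rightarrow> nat" where
  "len xs = cox_length I M (elt xs)"

definition reduced :: "'i list \<Rightarrow> bool" where
  "reduced xs \<longleftrightarrow> set xs \<subseteq> I \<and> length xs = len xs"

definition desc :: "'i \<Rightarrow> 'i list \<Rightarrow> bool" where
  "desc i xs \<longleftrightarrow> len (i # xs) < len xs"

lemma matrix_diag: "i \<in> I \<Longrightarrow> M i i = enat 1"
  using matrix by (simp add: coxeter_matrix_def one_enat_def)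

lemma matrix_sym: "i \<in> I \<Longrightarrow> j \<in> I \<Longrightarrow> M i j = M j i"
  using matrix by (simp add: coxeter_matrix_def)

lemma matrix_ge2: "i \<in> I \<Longrightarrow> j \<in> I \<Longrightarrow> i \<noteq> j \<Longrightarrow> 2 \<le> M i j"
  using matrix by (simp add: coxeter_matrix_def)

lemma finite_I: "finite I"
  using matrix by (simp add: coxeter_matrix_def)

sublocale W: group "coxeter_group I M"
  using matrix by (rule group_coxeter_group)

lemma elt_closed [simp]: "set xs \<subseteq> I \<Longrightarrow> elt xs \<in> carrier (coxeter_group I M)"
  unfolding cox_elt_def coxeter_group_def by (rule presented_monoid_carrierI) auto

lemma elt_append:
  "set xs \<subseteq> I \<Longrightarrow> set ys \<subseteq> I \<Longrightarrow> elt (xs @ ys) = elt xs \<otimes>\<^bsub>coxeter_group I M\<^esub> elt ys"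
  unfolding cox_elt_def coxeter_group_def
  by (rule presented_monoid_mult[OF coxeter_rels_lists, symmetric]) auto

lemma elt_Nil: "elt [] = \<one>\<^bsub>coxeter_group I M\<^esub>"
  by (simp add: cox_elt_def coxeter_group_def presented_monoid_one)

lemma elt_eq_iff:
  "set xs \<subseteq> I \<Longrightarrow> set ys \<subseteq> I \<Longrightarrow> elt xs = elt ys \<longleftrightarrow> (xs, ys) \<in> word_cong I (coxeter_rels I M)"
  unfolding cox_elt_def
  by (rule eq_equiv_class_iff[OF equiv_word_cong[OF coxeter_rels_lists]]) auto

lemma elt_relator:
  assumes "i \<in> I" "j \<in> I" "M i j = enat m"
  shows "elt (alt_word (2 * m) i j) = elt []"
proof -
  have "(alt_word (2 * m) i j, []) \<in> coxeter_rels I M"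
    unfolding coxeter_rels_def using assms concat_replicate_alt_word[of m i j, symmetric] by blast
  then show ?thesis
    using assms by (subst elt_eq_iff) (auto intro: word_cong.rel dest: subsetD[OF set_alt_word])
qed

lemma elt_square: "i \<in> I \<Longrightarrow> elt [i, i] = elt []"
  using elt_relator[OF _ _ matrix_diag, of i] by (simp add: numeral_2_eq_2)

lemma elt_rev: "set xs \<subseteq> I \<Longrightarrow> elt (rev xs) = inv\<^bsub>coxeter_group I M\<^esub> elt xs"
proof (induction xs)
  case Nil
  show ?case by (simp add: elt_Nil)
next
  case (Cons x xs)
  have "inv\<^bsub>coxeter_group I M\<^esub> elt [x] = elt [x]"
    using Cons.prems elt_square[of x] elt_append[of "[x]" "[x]"]
    by (intro W.inv_equality) (auto simp: elt_Nil)
  moreover have "elt (x # xs) = elt [x] \<otimes>\<^bsub>coxeter_group I M\<^esub> elt xs"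
    using Cons.prems elt_append[of "[x]" xs] by auto
  ultimately show ?case
    using Cons by (simp add: elt_append W.inv_mult_group)
qed

lemma elt_move_left:
  assumes "set p \<subseteq> I" "set a \<subseteq> I" "set b \<subseteq> I"
  shows "elt (p @ a) = elt b \<longleftrightarrow> elt a = elt (rev p @ b)"
  using assms W.inv_solve_left[of "elt a" "elt p" "elt b"] by (auto simp: elt_append elt_rev)

lemma elt_move_right:
  assumes "set p \<subseteq> I" "set a \<subseteq> I" "set b \<subseteq> I"
  shows "elt (a @ p) = elt b \<longleftrightarrow> elt a = elt (b @ rev p)"
  using assms W.inv_solve_right[of "elt a" "elt b" "elt p"] by (auto simp: elt_append elt_rev)

lemma elt_cancel_left:
  assumes "set p \<subseteq> I" "set a \<subseteq> I" "set b \<subseteq> I"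
  shows "elt (p @ a) = elt (p @ b) \<longleftrightarrow> elt a = elt b"
  using assms by (simp add: elt_append)

lemma elt_cancel_right:
  assumes "set p \<subseteq> I" "set a \<subseteq> I" "set b \<subseteq> I"
  shows "elt (a @ p) = elt (b @ p) \<longleftrightarrow> elt a = elt b"
  using assms by (simp add: elt_append)

lemma elt_cong_append:
  "set a \<subseteq> I \<Longrightarrow> set b \<subseteq> I \<Longrightarrow> set c \<subseteq> I \<Longrightarrow> set d \<subseteq> I \<Longrightarrow> elt a = elt b \<Longrightarrow> elt c = elt d \<Longrightarrow>
    elt (a @ c) = elt (b @ d)"
  by (simp add: elt_append)

lemma elt_Cons_cancel:
  "i \<in> I \<Longrightarrow> set a \<subseteq> I \<Longrightarrow> set b \<subseteq> I \<Longrightarrow> elt (i # a) = elt (i # b) \<longleftrightarrow> elt a = elt b"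
  using elt_cancel_left[of "[i]" a b] by simp

lemma elt_Cons_move:
  "i \<in> I \<Longrightarrow> set a \<subseteq> I \<Longrightarrow> set b \<subseteq> I \<Longrightarrow> elt (i # a) = elt b \<longleftrightarrow> elt a = elt (i # b)"
  using elt_move_left[of "[i]" a b] by simp

lemma elt_Cons_Cons: "i \<in> I \<Longrightarrow> set a \<subseteq> I \<Longrightarrow> elt (i # i # a) = elt a"
  using elt_Cons_move[of i "i # a" a] by auto

lemma elt_rev_cancel:
  "set p \<subseteq> I \<Longrightarrow> set a \<subseteq> I \<Longrightarrow> elt (rev p @ p @ a) = elt a"
  "set p \<subseteq> I \<Longrightarrow> set a \<subseteq> I \<Longrightarrow> elt (p @ rev p @ a) = elt a"
  using elt_move_left[of p a "p @ a"] elt_move_left[of p "rev p @ a" a] by auto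

lemma elt_rev_cong: "set a \<subseteq> I \<Longrightarrow> set b \<subseteq> I \<Longrightarrow> elt a = elt b \<Longrightarrow> elt (rev a) = elt (rev b)"
  by (simp add: elt_rev)

lemma elt_braid:
  assumes "i \<in> I" "j \<in> I" "M i j = enat m"
  shows "elt (alt_word m i j) = elt (alt_word m j i)"
  using elt_relator[OF assms] assms
    elt_move_right[of "rev (alt_word m j i)" "alt_word m i j" "[]"]
  by (simp add: alt_word_double alt_word_subset)

section \<open>Length, reduced words and left descents\<close>

lemma len_le: "set xs \<subseteq> I \<Longrightarrow> len xs \<le> length xs"
  unfolding len_def cox_length_def by (rule Least_le) auto

lemma len_cong: "elt xs = elt ys \<Longrightarrow> len xs = len ys"
  by (simp add: len_def)

lemma ex_reduced:
  assumes "set xs \<subseteq> I"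
  obtains ys where "reduced ys" "elt ys = elt xs" "length ys = len xs"
proof -
  have "\<exists>n. \<exists>ys\<in>lists I. length ys = n \<and> elt ys = elt xs"
    using assms by (auto intro!: bexI[of _ xs])
  then have "\<exists>ys\<in>lists I. length ys = len xs \<and> elt ys = elt xs"
    unfolding len_def cox_length_def by (rule LeastI_ex)
  then obtain ys where "ys \<in> lists I" "length ys = len xs" "elt ys = elt xs"
    by blast
  with len_cong[of ys xs] show ?thesis
    by (intro that[of ys]) (auto simp: reduced_def)
qed

lemma len_append:
  assumes "set xs \<subseteq> I" "set ys \<subseteq> I"
  shows "len (xs @ ys) \<le> len xs + len ys"
proof -
  obtain xs' where xs': "reduced xs'" "elt xs' = elt xs" "length xs' = len xs"
    using ex_reduced assms by blast
  obtain ys' where ys': "reduced ys'" "elt ys' = elt ys" "length ys' = len ys"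
    using ex_reduced assms by blast
  have "len (xs @ ys) = len (xs' @ ys')"
    using assms xs' ys' by (intro len_cong elt_cong_append) (auto simp: reduced_def)
  also have "\<dots> \<le> length (xs' @ ys')"
    using xs' ys' by (intro len_le) (auto simp: reduced_def)
  finally show ?thesis using xs' ys' by simp
qed

lemma len_Nil [simp]: "len [] = 0"
  using len_le[of "[]"] by simp

lemma len_0: "set xs \<subseteq> I \<Longrightarrow> len xs = 0 \<Longrightarrow> elt xs = elt []"
  by (metis ex_reduced length_0_conv)

lemma len_rev:
  assumes "set xs \<subseteq> I"
  shows "len (rev xs) = len xs"
proof -
  have "len (rev ys) \<le> len ys" if ys: "set ys \<subseteq> I" for ys
  proof -
    obtain zs where zs: "reduced zs" "elt zs = elt ys" "length zs = len ys"
      using ex_reduced ys by blast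
    then have "elt (rev zs) = elt (rev ys)"
      using ys by (intro elt_rev_cong) (auto simp: reduced_def)
    then show ?thesis
      using zs len_le[of "rev zs"] len_cong[of "rev zs" "rev ys"] by (auto simp: reduced_def)
  qed
  from this[of xs] this[of "rev xs"] assms show ?thesis by simp
qed

text \<open>All relators have even length, so the parity of a word is the sign of its
  element.\<close>

lemma even_length_cong:
  "(xs, ys) \<in> word_cong I (coxeter_rels I M) \<Longrightarrow> even (length xs) = even (length ys)"
  by (induction rule: word_cong.induct) (auto simp: coxeter_rels_def concat_replicate_alt_word)

lemma even_len: "set xs \<subseteq> I \<Longrightarrow> even (len xs) = even (length xs)"
  using even_length_cong by (metis elt_eq_iff ex_reduced reduced_def)

lemma len_Cons_le: "i \<in> I \<Longrightarrow> set xs \<subseteq> I \<Longrightarrow> len (i # xs) \<le> Suc (len xs)"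
  using len_append[of "[i]" xs] len_le[of "[i]"] by simp

lemma len_le_Cons: "i \<in> I \<Longrightarrow> set xs \<subseteq> I \<Longrightarrow> len xs \<le> Suc (len (i # xs))"
  using len_Cons_le[of i "i # xs"] len_cong[OF elt_Cons_Cons] by simp

lemma len_Cons_neq: "i \<in> I \<Longrightarrow> set xs \<subseteq> I \<Longrightarrow> len (i # xs) \<noteq> len xs"
  using even_len[of "i # xs"] even_len[of xs] by auto

lemma len_desc: "i \<in> I \<Longrightarrow> set xs \<subseteq> I \<Longrightarrow> desc i xs \<Longrightarrow> len xs = Suc (len (i # xs))"
  using len_le_Cons[of i xs] by (auto simp: desc_def)

lemma len_not_desc: "i \<in> I \<Longrightarrow> set xs \<subseteq> I \<Longrightarrow> \<not> desc i xs \<Longrightarrow> len (i # xs) = Suc (len xs)"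
  using len_Cons_le[of i xs] len_Cons_neq[of i xs] by (auto simp: desc_def)

lemma desc_cong:
  assumes "elt xs = elt ys" "set xs \<subseteq> I" "set ys \<subseteq> I" "i \<in> I"
  shows "desc i xs = desc i ys"
  using assms len_cong[of xs ys] len_cong[of "i # xs" "i # ys"]
  by (simp add: desc_def elt_Cons_cancel)

lemma reducedD: "reduced xs \<Longrightarrow> set xs \<subseteq> I" "reduced xs \<Longrightarrow> len xs = length xs"
  by (auto simp: reduced_def)

lemma reduced_appendD:
  assumes "reduced (xs @ ys)"
  shows "reduced xs" "reduced ys"
  using assms len_append[of xs ys] len_le[of xs] len_le[of ys] by (auto simp: reduced_def)

lemma reduced_ConsD: "reduced (x # xs) \<Longrightarrow> reduced xs"
  using reduced_appendD(2)[of "[x]"] by simp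

lemma desc_Cons: "reduced (i # xs) \<Longrightarrow> desc i (i # xs)"
  using len_cong[OF elt_Cons_Cons, of i xs] reduced_ConsD[of i xs] by (auto simp: reduced_def desc_def)

lemma reduced_Cons: "i \<in> I \<Longrightarrow> reduced xs \<Longrightarrow> \<not> desc i xs \<Longrightarrow> reduced (i # xs)"
  using len_not_desc[of i xs] by (auto simp: reduced_def)

text \<open>The number of \<open>k\<close> such that the reflection
  \<open>x\<^sub>1 \<dots> x\<^sub>k\<^sub>-\<^sub>1 x\<^sub>k x\<^sub>k\<^sub>-\<^sub>1 \<dots> x\<^sub>1\<close> equals \<open>t\<close>; its parity depends only on the group element
  \<open>x\<^sub>1 \<dots> x\<^sub>n\<close>.\<close>

fun refl_count :: "'i list \<Rightarrow> 'i list \<Rightarrow> nat" where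
  "refl_count [] t = 0"
| "refl_count (x # xs) t = of_bool (elt [x] = elt t) + refl_count xs (x # t @ [x])"

lemma refl_count_cong:
  "set xs \<subseteq> I \<Longrightarrow> set t \<subseteq> I \<Longrightarrow> set t' \<subseteq> I \<Longrightarrow> elt t = elt t' \<Longrightarrow> refl_count xs t = refl_count xs t'"
proof (induction xs arbitrary: t t')
  case (Cons x xs)
  have "elt (x # t @ [x]) = elt (x # t' @ [x])"
    using Cons.prems elt_cancel_right[of "[x]" t t'] by (subst elt_Cons_cancel) auto
  then have "refl_count xs (x # t @ [x]) = refl_count xs (x # t' @ [x])"
    using Cons.prems by (intro Cons.IH) auto
  then show ?case using Cons.prems by simp
qed simp

lemma refl_count_append:
  "refl_count (xs @ ys) t = refl_count xs t + refl_count ys (rev xs @ t @ xs)"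
  by (induction xs arbitrary: t) auto

text \<open>The palindrome formed from the prefix of length \<open>a + 1\<close> is again
  alternating, of length \<open>2 * a + 1\<close>.\<close>

lemma refl_count_alt_word:
  "i \<in> I \<Longrightarrow> j \<in> I \<Longrightarrow> set t \<subseteq> I \<Longrightarrow>
    refl_count (alt_word n i j) t = (\<Sum>a<n. of_bool (elt (alt_word (2 * a + 1) i j) = elt t))"
proof (induction n arbitrary: i j t)
  case (Suc n)
  have *: "elt (alt_word (2 * a + 1) j i) = elt (i # t @ [i]) \<longleftrightarrow>
      elt (alt_word (2 * Suc a + 1) i j) = elt t" for a
  proof -
    have "alt_word (2 * Suc a + 1) i j = i # alt_word (2 * a + 1) j i @ [i]"
      using alt_word_Suc_right[of "2 * a + 1" j i] by simp
    moreover have "set (alt_word (2 * a + 1) j i) \<subseteq> I"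
      using Suc.prems alt_word_subset by metis
    ultimately show ?thesis
      using Suc.prems elt_Cons_move[of i "alt_word (2 * a + 1) j i @ [i]" t]
        elt_move_right[of "[i]" "alt_word (2 * a + 1) j i" "i # t"]
      by auto
  qed
  have "refl_count (alt_word n j i) (i # t @ [i]) =
      (\<Sum>a<n. of_bool (elt (alt_word (2 * a + 1) j i) = elt (i # t @ [i])))"
    using Suc.prems by (intro Suc.IH) auto
  then show ?case
    unfolding sum.lessThan_Suc_shift * by simp
qed simp

text \<open>Shifting the index by \<open>m\<close> prepends the relator and so leaves the reflection
  unchanged; the second half of the count repeats the first.\<close>

lemma even_refl_count_relator:
  assumes "i \<in> I" "j \<in> I" "M i j = enat m" "set t \<subseteq> I"
  shows "even (refl_count (alt_word (2 * m) i j) t)"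
proof -
  let ?f = "\<lambda>a. of_bool (elt (alt_word (2 * a + 1) i j) = elt t) :: nat"
  have "elt (alt_word (2 * (a + m) + 1) i j) = elt (alt_word (2 * a + 1) i j)" for a
  proof -
    have "alt_word (2 * (a + m) + 1) i j = alt_word (2 * m) i j @ alt_word (2 * a + 1) i j"
      using alt_word_add[of "2 * m" "2 * a + 1" i j] by (simp add: algebra_simps)
    then show ?thesis
      using elt_cong_append[of "alt_word (2 * m) i j" "[]" "alt_word (2 * a + 1) i j"
          "alt_word (2 * a + 1) i j"] elt_relator[OF assms(1-3)] assms(1,2)
        alt_word_subset[of i I j] by (metis append_Nil empty_set empty_subsetI)
  qed
  then have "(\<Sum>a<m. ?f (a + m)) = (\<Sum>a<m. ?f a)" by simp
  moreover have "(\<Sum>a<m + n. ?f a) = (\<Sum>a<m. ?f a) + (\<Sum>a<n. ?f (a + m))" for n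
    by (induction n) (simp_all add: add.commute[of _ m])
  from this[of m] have "(\<Sum>a<2 * m. ?f a) = (\<Sum>a<m. ?f a) + (\<Sum>a<m. ?f (a + m))"
    by (simp only: mult_2)
  ultimately have "(\<Sum>a<2 * m. ?f a) = 2 * (\<Sum>a<m. ?f a)" by simp
  then show ?thesis
    using refl_count_alt_word[OF assms(1,2,4), of "2 * m"] by simp
qed

lemma even_refl_count:
  assumes "(xs, ys) \<in> word_cong I (coxeter_rels I M)"
  shows "\<forall>t. set t \<subseteq> I \<longrightarrow> even (refl_count xs t) = even (refl_count ys t)"
  using assms
proof (induction rule: word_cong.induct)
  case (rel xs ys)
  then show ?case
    by (auto simp: coxeter_rels_def concat_replicate_alt_word even_refl_count_relator)
next
  case (append xs ys us vs)
  show ?case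
  proof (intro allI impI)
    fix t
    assume t: "set t \<subseteq> I"
    have sets: "set xs \<subseteq> I" "set ys \<subseteq> I" "set us \<subseteq> I" "set vs \<subseteq> I"
      using append.hyps word_cong_in_lists[OF coxeter_rels_lists] by fastforce+
    have xy: "elt xs = elt ys" using append.hyps sets by (simp add: elt_eq_iff)
    \<comment> \<open>Equal elements conjugate \<open>t\<close> to equal elements, so the second
      factors are counted against the same reflection.\<close>
    have "elt (rev xs @ t @ xs) = elt (rev ys @ t @ ys)"
      using sets t xy by (intro elt_cong_append elt_rev_cong HOL.refl) auto
    then have "refl_count us (rev xs @ t @ xs) = refl_count us (rev ys @ t @ ys)"
      using sets t by (intro refl_count_cong) auto
    then show "even (refl_count (xs @ us) t) = even (refl_count (ys @ vs) t)"
      using append.IH t sets by (simp add: refl_count_append)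
  qed
qed auto

text \<open>Multiplying from the left by the reflection that belongs to a letter cancels that
  letter.\<close>

lemma refl_count_delete:
  assumes "set xs \<subseteq> I" "set t \<subseteq> I" "refl_count xs t > 0"
  shows "\<exists>us y vs. xs = us @ y # vs \<and> elt (t @ xs) = elt (us @ vs)"
  using assms
proof (induction xs arbitrary: t)
  case (Cons x xs)
  show ?case
  proof (cases "elt [x] = elt t")
    case True
    then have "elt (t @ x # xs) = elt ([x] @ x # xs)"
      using Cons.prems by (intro elt_cong_append) auto
    then have "elt (t @ x # xs) = elt ([] @ xs)"
      using Cons.prems elt_Cons_Cons by simp
    then show ?thesis by blast
  next
    case False
    then obtain us y vs where *: "xs = us @ y # vs" "elt ((x # t @ [x]) @ xs) = elt (us @ vs)"
      using Cons.IH[of "x # t @ [x]"] Cons.prems by auto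
    then have "elt (t @ x # xs) = elt (x # us @ vs)"
      using Cons.prems elt_Cons_move[of x "t @ x # xs" "us @ vs"] by auto
    with * show ?thesis by (metis append_Cons)
  qed
qed simp

text \<open>Prefixing \<open>i\<close> to a reduced word for the shorter element gives a word for
  the same element as \<open>xs\<close> in which the reflection \<open>[i]\<close> is counted
  exactly once; parity carries this over to \<open>xs\<close>.\<close>

lemma odd_refl_count_desc:
  assumes "set xs \<subseteq> I" "i \<in> I" "desc i xs"
  shows "odd (refl_count xs [i])"
proof -
  obtain ys where ys: "reduced ys" "elt ys = elt (i # xs)" "length ys = len (i # xs)"
    using ex_reduced[of "i # xs"] assms by auto
  note ysI = reducedD(1)[OF ys(1)]
  have xs: "elt (i # ys) = elt xs"
    using ys ysI assms elt_Cons_move by metis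
  \<comment> \<open>Otherwise deleting a letter of \<open>ys\<close> gives a word for the element of
    \<open>xs\<close> that is shorter than \<open>len (i # xs)\<close>, against
    \<open>desc i xs\<close>.\<close>
  have "refl_count ys [i] = 0"
  proof (rule ccontr)
    assume "refl_count ys [i] \<noteq> 0"
    then obtain us y vs where *: "ys = us @ y # vs" "elt ([i] @ ys) = elt (us @ vs)"
      using refl_count_delete[of ys "[i]"] ysI assms by auto
    then have "len xs \<le> length (us @ vs)"
      using xs ysI len_le[of "us @ vs"] len_cong[of xs "us @ vs"] by auto
    then show False
      using * ys assms(3) by (auto simp: desc_def)
  qed
  moreover have "refl_count ys [i, i, i] = refl_count ys [i]"
    using assms ysI elt_Cons_Cons[of i "[i]"] by (intro refl_count_cong) auto
  ultimately have "odd (refl_count (i # ys) [i])" by simp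
  moreover have "(i # ys, xs) \<in> word_cong I (coxeter_rels I M)"
    using xs assms ysI by (subst elt_eq_iff[symmetric]) auto
  ultimately show ?thesis
    using even_refl_count[of "i # ys" xs, THEN spec, of "[i]"] assms(2) by simp
qed

lemma exchange:
  assumes "set xs \<subseteq> I" "i \<in> I" "desc i xs"
  obtains us y vs where "xs = us @ y # vs" "elt (i # xs) = elt (us @ vs)"
proof -
  have "refl_count xs [i] > 0"
    using odd_refl_count_desc[OF assms] by (rule odd_pos)
  then have "\<exists>us y vs. xs = us @ y # vs \<and> elt ([i] @ xs) = elt (us @ vs)"
    using assms(1,2) by (intro refl_count_delete) simp_all
  then show ?thesis
    using that by auto
qed

text \<open>Exchange only deletes letters, so a reduced word is reached without leaving
  \<open>K\<close>.\<close>

lemma reduced_subset: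
  assumes "K \<subseteq> I" "set xs \<subseteq> K"
  obtains ys where "reduced ys" "set ys \<subseteq> K" "elt ys = elt xs"
proof -
  have "\<exists>ys. reduced ys \<and> set ys \<subseteq> K \<and> elt ys = elt xs"
    using assms(2)
  proof (induction xs)
    case Nil
    then show ?case by (auto simp: reduced_def intro!: exI[of _ "[]"])
  next
    case (Cons x xs)
    then obtain ys where ys: "reduced ys" "set ys \<subseteq> K" "elt ys = elt xs" by auto
    have x: "x \<in> I" "x \<in> K" and xsI: "set xs \<subseteq> I" using Cons.prems assms by auto
    note ysI = reducedD[OF ys(1)]
    have eq: "elt (x # ys) = elt (x # xs)"
      using x xsI ysI ys by (simp add: elt_Cons_cancel)
    show ?case
    proof (cases "desc x ys")
      case False
      then show ?thesis using reduced_Cons[OF x(1) ys(1)] eq ys x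
        by (intro exI[of _ "x # ys"]) auto
    next
      case True
      then obtain us y vs where *: "ys = us @ y # vs" "elt (x # ys) = elt (us @ vs)"
        using exchange ysI x by blast
      have "len (us @ vs) = len (x # ys)" using * len_cong by metis
      moreover have "Suc (len (x # ys)) = length ys"
        using len_desc[OF x(1) ysI(1) True] ysI by simp
      ultimately have "reduced (us @ vs)" using * ysI by (auto simp: reduced_def)
      then show ?thesis using * ys eq by (intro exI[of _ "us @ vs"]) auto
    qed
  qed
  then show ?thesis using that by blast
qed


section \<open>Maximal and minimal elements of parabolic cosets\<close>

text \<open>Maximality in the parabolic subgroup is encoded by descents, a condition that is checked
  on generators; \<open>len_longest\<close> recovers maximality of length. The word itself may be
  non-reduced.\<close>

definition is_longest :: "'i set \<Rightarrow> 'i list \<Rightarrow> bool" where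
  "is_longest K v \<longleftrightarrow> set v \<subseteq> K \<and> (\<forall>k\<in>K. desc k v)"

lemma len_rev_append:
  assumes "set us \<subseteq> I" "set v \<subseteq> I"
  shows "len v \<le> len us + len (rev us @ v)"
  using assms len_append[of us "rev us @ v"] len_cong[OF elt_rev_cancel(2), of us v] by simp

text \<open>The word \<open>us\<close> is split off letter by letter. With \<open>z\<close> a
  reduced word for the rest, exchange applied to \<open>us @ z\<close> cannot delete a letter of
  \<open>us\<close>, because \<open>k # us\<close> is reduced; so it deletes one of
  \<open>z\<close>, and the rest gets shorter.\<close>

lemma len_all_desc_reduced:
  assumes "K \<subseteq> I" "set v \<subseteq> I" "\<And>k. k \<in> K \<Longrightarrow> desc k v"
  shows "reduced us \<Longrightarrow> set us \<subseteq> K \<Longrightarrow> len v = length us + len (rev us @ v)"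
proof (induction us)
  case (Cons k us)
  have k: "k \<in> K" "k \<in> I" and us: "reduced us" "set us \<subseteq> I"
    using Cons.prems assms(1) reduced_ConsD by auto
  have IH: "len v = length us + len (rev us @ v)"
    using Cons.IH us Cons.prems by auto
  obtain z where z: "reduced z" "elt z = elt (rev us @ v)" "length z = len (rev us @ v)"
    using ex_reduced[of "rev us @ v"] us assms(2) by auto
  note zI = reducedD(1)[OF z(1)]
  have v: "elt (us @ z) = elt v"
    using z(2) us zI assms(2) by (simp add: elt_move_left)
  have "desc k (us @ z)"
    using assms v k us zI desc_cong[of "us @ z" v k] by auto
  then obtain p y q where *: "us @ z = p @ y # q" "elt (k # us @ z) = elt (p @ q)"
    using exchange[of "us @ z" k] us zI k by auto
  have pqI: "set p \<subseteq> I" "set q \<subseteq> I" "y \<in> I"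
    using *(1) us zI by (metis Un_subset_iff insert_subset list.simps(15) set_append)+
  \<comment> \<open>The deleted letter lies either in \<open>us\<close> or in
    \<open>z\<close>.\<close>
  from *(1) consider p' where "us = p @ y # p'" "q = p' @ z"
    | p' where "p = us @ p'" "z = p' @ y # q"
    by (fastforce simp: append_eq_append_conv2 append_eq_Cons_conv)
  then have "len (rev (k # us) @ v) < length z"
  proof cases
    case 1
    then have "elt ((k # us) @ z) = elt ((p @ p') @ z)" using *(2) by simp
    then have "elt (k # us) = elt (p @ p')"
      using k us zI 1 pqI by (subst (asm) elt_cancel_right) auto
    then have "len (k # us) \<le> length (p @ p')"
      using len_le[of "p @ p'"] us 1 len_cong by (metis Un_subset_iff le_trans order_refl pqI(1,2) set_append)
    then show ?thesis using Cons.prems(1) 1 by (simp add: reduced_def)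
  next
    case 2
    have "elt (k # v) = elt (k # us @ z)"
      using v k us zI assms(2) by (subst elt_Cons_cancel) auto
    then have "elt (us @ p' @ q) = elt (k # v)" using * 2 by simp
    then have "elt (p' @ q) = elt (rev us @ k # v)"
      using us zI 2 k assms(2) by (subst (asm) elt_move_left) auto
    then have "len (rev (k # us) @ v) \<le> length (p' @ q)"
      using len_le[of "p' @ q"] len_cong[of "p' @ q" "rev us @ k # v"] 2 zI by simp
    then show ?thesis using 2 by simp
  qed
  \<comment> \<open>The triangle inequality bounds the drop by one, which turns the strict
    inequality into the exact value.\<close>
  moreover have "len v \<le> len (k # us) + len (rev (k # us) @ v)"
    using len_rev_append[of "k # us" v] us k assms(2) by auto
  ultimately show ?case
    using IH z Cons.prems(1) by (simp add: reduced_def)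
qed simp

lemma len_all_desc:
  assumes "K \<subseteq> I" "set v \<subseteq> I" "\<And>k. k \<in> K \<Longrightarrow> desc k v" "set u \<subseteq> K"
  shows "len (u @ v) + len u = len v"
proof -
  obtain z where z: "reduced z" "set z \<subseteq> K" "elt z = elt (rev u)"
    using reduced_subset[of K "rev u"] assms by auto
  have uI: "set u \<subseteq> I" using assms by auto
  have "elt (rev z) = elt u"
    using z uI elt_rev_cong[of z "rev u"] by (simp add: reduced_def)
  then have "elt (rev z @ v) = elt (u @ v)"
    using uI assms z by (intro elt_cong_append) (auto simp: reduced_def)
  moreover have "len z = len u" using len_cong[OF z(3)] len_rev[OF uI] by simp
  ultimately show ?thesis
    using len_all_desc_reduced[OF assms(1-3) z(1,2)] z(1) len_cong[of "rev z @ v" "u @ v"]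
    by (simp add: reduced_def)
qed

lemma len_longest:
  assumes "K \<subseteq> I" "is_longest K v" "set u \<subseteq> K"
  shows "len (u @ v) + len u = len v"
  using assms by (intro len_all_desc[of K]) (auto simp: is_longest_def)

text \<open>By \<open>len_longest\<close> in both directions the two lengths agree, so the quotient
  has length zero.\<close>

lemma longest_unique:
  assumes "K \<subseteq> I" "is_longest K v" "is_longest K v'"
  shows "elt v = elt v'"
proof -
  have sub: "set v \<subseteq> K" "set v' \<subseteq> K" "set v \<subseteq> I" "set v' \<subseteq> I"
    using assms by (auto simp: is_longest_def)
  have "len (rev v' @ v) = 0"
    using len_longest[OF assms(1,2), of "rev v'"] len_longest[OF assms(1,3), of "rev v"] sub
    by (simp add: len_rev)
  then have "elt (rev v' @ v) = elt []"
    using sub by (intro len_0) auto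
  then show ?thesis using sub by (subst (asm) elt_move_left) auto
qed

text \<open>The same exchange argument as in \<open>len_all_desc_reduced\<close>: deleting a letter
  from the part of \<open>X\<close> would produce an element of its coset that is shorter than
  \<open>X\<close>.\<close>

lemma len_append_minimal:
  assumes "K \<subseteq> I" "set X \<subseteq> I" "\<And>u. set u \<subseteq> K \<Longrightarrow> len X \<le> len (u @ X)"
  shows "reduced us \<Longrightarrow> set us \<subseteq> K \<Longrightarrow> len (us @ X) = length us + len X"
proof (induction us)
  case (Cons k us)
  have k: "k \<in> K" "k \<in> I" and us: "reduced us" "set us \<subseteq> I" "set us \<subseteq> K"
    using Cons.prems assms(1) reduced_ConsD by auto
  have IH: "len (us @ X) = length us + len X"
    using Cons.IH us Cons.prems by auto
  obtain z where z: "reduced z" "elt z = elt X" "length z = len X"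
    using ex_reduced[of X] assms(2) by auto
  note zI = reducedD(1)[OF z(1)]
  have v: "elt (us @ z) = elt (us @ X)"
    using z(2) us zI assms(2) by (simp add: elt_cancel_left)
  have "\<not> desc k (us @ X)"
  proof
    assume "desc k (us @ X)"
    then have "desc k (us @ z)"
      using assms v k us zI desc_cong[of "us @ z" "us @ X" k] by auto
    then obtain p y q where *: "us @ z = p @ y # q" "elt (k # us @ z) = elt (p @ q)"
      using exchange[of "us @ z" k] us zI k by auto
    have pqI: "set p \<subseteq> I" "set q \<subseteq> I" "y \<in> I"
      using *(1) us zI by (metis Un_subset_iff insert_subset list.simps(15) set_append)+
    from *(1) consider p' where "us = p @ y # p'" "q = p' @ z"
      | p' where "p = us @ p'" "z = p' @ y # q"
      by (fastforce simp: append_eq_append_conv2 append_eq_Cons_conv)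
    then show False
    proof cases
      case 1
      then have "elt ((k # us) @ z) = elt ((p @ p') @ z)" using *(2) by simp
      then have "elt (k # us) = elt (p @ p')"
        using k us zI 1 pqI by (subst (asm) elt_cancel_right) auto
      then have "len (k # us) \<le> length (p @ p')"
        using len_le[of "p @ p'"] us 1 len_cong by (metis Un_subset_iff le_trans order_refl pqI(1,2) set_append)
      then show False using Cons.prems(1) 1 by (simp add: reduced_def)
    next
      case 2
      have "elt (us @ p' @ q) = elt (k # us @ z)" using * 2 by simp
      also have "\<dots> = elt ((k # us) @ X)"
        using v k us zI assms(2) elt_Cons_cancel[of k "us @ z" "us @ X"] by simp
      \<comment> \<open>\<open>rev us @ k # us\<close> is a word over \<open>K\<close>, so this
        element lies in the coset of \<open>X\<close>.\<close>
      finally have "elt (p' @ q) = elt ((rev us @ k # us) @ X)"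
        using us zI 2 k assms(2) by (subst (asm) elt_move_left) auto
      then have "len ((rev us @ k # us) @ X) \<le> length (p' @ q)"
        using len_le[of "p' @ q"] len_cong[of "p' @ q" "(rev us @ k # us) @ X"] 2 zI by simp
      moreover have "len X \<le> len ((rev us @ k # us) @ X)"
        using us k by (intro assms(3)) auto
      ultimately show False using 2 z by simp
    qed
  qed
  then show ?case
    using len_not_desc[of k "us @ X"] k us assms(2) IH by simp
qed simp

text \<open>Factorization through a shortest element of the coset of \<open>X\<close> under the
  parabolic subgroup of \<open>K\<close>.\<close>

lemma ex_minimal:
  assumes "K \<subseteq> I" "set X \<subseteq> I"
  obtains u X' where "reduced u" "set u \<subseteq> K" "set X' \<subseteq> I" "elt X = elt (u @ X')"
    "\<And>us. reduced us \<Longrightarrow> set us \<subseteq> K \<Longrightarrow> len (us @ X') = length us + len X'"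
proof -
  define n where "n = (LEAST n. \<exists>u. set u \<subseteq> K \<and> len (u @ X) = n)"
  have "\<exists>u. set u \<subseteq> K \<and> len (u @ X) = n"
    unfolding n_def by (rule LeastI_ex) (auto intro: exI[of _ "[]"])
  then obtain w where w: "set w \<subseteq> K" "len (w @ X) = n" by auto
  have min: "n \<le> len (u @ X)" if "set u \<subseteq> K" for u
    unfolding n_def using that by (intro Least_le) auto
  have wI: "set w \<subseteq> I" using w assms by auto
  obtain u where u: "reduced u" "set u \<subseteq> K" "elt u = elt (rev w)"
    using reduced_subset[of K "rev w"] w assms by auto
  have "elt (u @ w @ X) = elt (rev w @ w @ X)"
    using u wI assms by (intro elt_cong_append) (auto simp: reduced_def)
  then have "elt X = elt (u @ w @ X)"
    using elt_rev_cancel wI assms by simp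
  then show ?thesis
  proof (intro that[of u "w @ X"])
    show "len (us @ w @ X) = length us + len (w @ X)" if "reduced us" "set us \<subseteq> K" for us
      using that w min wI assms by (intro len_append_minimal[of K]) (auto simp flip: append_assoc)
  qed (use u wI assms in auto)
qed

text \<open>In the factorization of \<open>X\<close> from \<open>ex_minimal\<close> the factor over
  \<open>K\<close> is empty, since its first letter would be a descent of \<open>X\<close>; so
  \<open>X\<close> is itself minimal in its coset.\<close>

lemma len_append_no_desc:
  assumes "K \<subseteq> I" "set X \<subseteq> I" "\<And>k. k \<in> K \<Longrightarrow> \<not> desc k X" "reduced us" "set us \<subseteq> K"
  shows "len (us @ X) = length us + len X"
proof -
  obtain u X' where u: "reduced u" "set u \<subseteq> K" "set X' \<subseteq> I" "elt X = elt (u @ X')"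
    "\<And>us. reduced us \<Longrightarrow> set us \<subseteq> K \<Longrightarrow> len (us @ X') = length us + len X'"
    using ex_minimal[OF assms(1,2)] by blast
  have "u = []"
  proof (cases u)
    case (Cons k u')
    have "elt (k # X) = elt (u' @ X')"
      using u(1-4) Cons assms(1,2) elt_Cons_move[of k "u' @ X'" X] by (auto simp: reduced_def)
    then have "len (k # X) = length u' + len X'"
      using u(5)[of u'] u(1,2) Cons reduced_ConsD[of k u'] len_cong[of "k # X" "u' @ X'"] by auto
    moreover have "len X = length u + len X'"
      using u(5)[of u] u(1,2) len_cong[OF u(4)] by simp
    ultimately have "desc k X" using Cons by (simp add: desc_def)
    then show ?thesis using assms(3)[of k] u(2) Cons by auto
  qed
  then have "elt X = elt X'" using u by simp
  then have "elt (us @ X) = elt (us @ X')"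
    using assms u by (intro elt_cong_append) auto
  then show ?thesis
    using u(5)[OF assms(4,5)] len_cong[of "us @ X" "us @ X'"] len_cong[of X X'] \<open>elt X = elt X'\<close> by simp
qed

text \<open>By \<open>len_all_desc\<close> each of the two elements is at least as long as the
  other, so their quotient has length zero. With two generators for \<open>K\<close> this gives the
  braid relations for the Hecke action.\<close>

lemma all_desc_unique:
  assumes K: "K \<subseteq> I" and X: "set X \<subseteq> I" and u: "set u \<subseteq> K" "set v \<subseteq> K"
    and d: "\<And>k. k \<in> K \<Longrightarrow> desc k (u @ X)" "\<And>k. k \<in> K \<Longrightarrow> desc k (v @ X)"
  shows "elt (u @ X) = elt (v @ X)"
proof -
  have I: "set u \<subseteq> I" "set v \<subseteq> I" using u K by auto
  have "len (v @ rev u @ u @ X) + len (v @ rev u) = len (u @ X)"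
    using len_all_desc[of K "u @ X" "v @ rev u"] K X u d I by auto
  moreover have "len (u @ rev v @ v @ X) + len (u @ rev v) = len (v @ X)"
    using len_all_desc[of K "v @ X" "u @ rev v"] K X u d I by auto
  moreover have vu: "elt (v @ rev u @ u @ X) = elt (v @ X)"
    using I X elt_rev_cancel by (subst elt_cancel_left) auto
  moreover have "elt (u @ rev v @ v @ X) = elt (u @ X)"
    using I X elt_rev_cancel by (subst elt_cancel_left) auto
  ultimately have "len (v @ rev u) = 0"
    using len_cong[of "v @ rev u @ u @ X" "v @ X"] len_cong[of "u @ rev v @ v @ X" "u @ X"] by simp
  then have "elt (v @ rev u) = elt []"
    using I by (intro len_0) auto
  then have "elt v = elt u"
    using I by (subst (asm) elt_move_right) auto
  then show ?thesis
    using I X by (simp add: elt_cancel_right)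
qed


section \<open>The orders of the products of two generators\<close>

text \<open>Coordinates of the geometric representation: \<open>f k\<close> is the value of the invariant form at
  \<open>v\<close> and the simple root \<open>\<alpha>\<^sub>k\<close>. Infinite entries of the Coxeter matrix are replaced by a finite
  number \<open>N\<close>, so that only the representation of a quotient of the Coxeter group is needed, and only
  rotations of finite order occur.\<close>

definition fin_entry :: "nat \<Rightarrow> 'i \<Rightarrow> 'i \<Rightarrow> nat" where
  "fin_entry N i j = (case M i j of enat n \<Rightarrow> n | \<infinity> \<Rightarrow> N)"

text \<open>The reflection \<open>v - 2 B(v, \<alpha>\<^sub>i) \<alpha>\<^sub>i\<close> in these
  coordinates; the form \<open>B\<close> has the value \<open>- cos (pi / m)\<close> at two simple
  roots with entry \<open>m\<close>.\<close>

definition geom_refl :: "nat \<Rightarrow> 'i \<Rightarrow> ('i \<Rightarrow> real) \<Rightarrow> 'i \<Rightarrow> real" where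
  "geom_refl N i f = (\<lambda>k. f k + 2 * f i * cos (pi / real (fin_entry N i k)))"

lemma fin_entry_diag: "i \<in> I \<Longrightarrow> fin_entry N i i = 1"
  by (simp add: fin_entry_def matrix_diag)

lemma fin_entry_sym: "i \<in> I \<Longrightarrow> j \<in> I \<Longrightarrow> fin_entry N i j = fin_entry N j i"
  using matrix_sym[of i j] by (simp add: fin_entry_def)

lemma fin_entry_ge2: "i \<in> I \<Longrightarrow> j \<in> I \<Longrightarrow> i \<noteq> j \<Longrightarrow> 2 \<le> N \<Longrightarrow> 2 \<le> fin_entry N i j"
  using matrix_ge2[of i j] by (auto simp: fin_entry_def numeral_eq_enat split: enat.split)

lemma geom_refl_invol: "i \<in> I \<Longrightarrow> geom_refl N i (geom_refl N i f) = f"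
  by (rule ext) (simp add: geom_refl_def fin_entry_diag)

lemma sin_step: "sin (x + t) = 2 * cos t * sin x - sin (x - t)" for x t :: real
  by (simp add: sin_add sin_diff)

text \<open>On the coordinates \<open>i\<close> and \<open>j\<close> the product of the two
  reflections is a rotation through \<open>2 * t\<close>; these are the formulas for its
  \<open>d\<close>-th power, cleared of the denominator \<open>sin t\<close>.\<close>

lemma foldr_geom_refl_alt_word:
  fixes f :: "'i \<Rightarrow> real" and d N :: nat
  assumes "i \<in> I" "j \<in> I" "i \<noteq> j"
  defines "t \<equiv> pi / real (fin_entry N i j)"
    and "g \<equiv> foldr (geom_refl N) (alt_word (2 * d) i j) f"
  shows "g i * sin t = - f i * sin (2 * real d * t - t) - f j * sin (2 * real d * t)"
    and "g j * sin t = f i * sin (2 * real d * t) + f j * sin (2 * real d * t + t)"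
proof -
  have refl_i: "geom_refl N i h i = - h i" "geom_refl N i h j = h j + 2 * h i * cos t" for h
    using assms by (simp_all add: geom_refl_def fin_entry_diag t_def)
  have refl_j: "geom_refl N j h j = - h j" "geom_refl N j h i = h i + 2 * h j * cos t" for h
    using assms by (simp_all add: geom_refl_def fin_entry_diag fin_entry_sym t_def)
  have "g i * sin t = - f i * sin (2 * real d * t - t) - f j * sin (2 * real d * t) \<and>
    g j * sin t = f i * sin (2 * real d * t) + f j * sin (2 * real d * t + t)"
    unfolding g_def
  proof (induction d)
    case (Suc d)
    let ?h = "foldr (geom_refl N) (alt_word (2 * d) i j) f"
    let ?x = "2 * real d * t"
    \<comment> \<open>Consecutive values of the sine in steps of \<open>t\<close>; from
      \<open>C\<close> on, each is determined by the two before it through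
      \<open>sin_step\<close>.\<close>
    define A B C D E where "A = sin (?x - t)" and "B = sin ?x" and "C = sin (?x + t)"
      and "D = sin (?x + t + t)" and "E = sin (?x + t + t + t)"
    have rec: "C = 2 * cos t * B - A" "D = 2 * cos t * C - B" "E = 2 * cos t * D - C"
      unfolding A_def B_def C_def D_def E_def
      using sin_step[of ?x t] sin_step[of "?x + t" t] sin_step[of "?x + t + t" t]
      by (simp_all only: add_diff_cancel_right')
    have IH: "?h i * sin t = - f i * A - f j * B" "?h j * sin t = f i * B + f j * C"
      using Suc by (simp_all add: A_def B_def C_def)
    have x: "2 * real (Suc d) * t = ?x + t + t"
      by (simp add: algebra_simps)
    have step: "foldr (geom_refl N) (alt_word (2 * Suc d) i j) f = geom_refl N i (geom_refl N j ?h)"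
      by simp
    have gi: "(- (?h i + 2 * ?h j * cos t)) * sin t = - f i * C - f j * D"
    proof -
      have "(- (?h i + 2 * ?h j * cos t)) * sin t = - (?h i * sin t) - 2 * cos t * (?h j * sin t)"
        by (simp add: algebra_simps)
      also have "\<dots> = - f i * C - f j * D"
        unfolding IH rec by (simp add: algebra_simps)
      finally show ?thesis .
    qed
    have "(- ?h j + 2 * (?h i + 2 * ?h j * cos t) * cos t) * sin t
        = - (?h j * sin t) - 2 * cos t * ((- (?h i + 2 * ?h j * cos t)) * sin t)"
      by (simp add: algebra_simps)
    also have "\<dots> = f i * D + f j * E"
      unfolding gi unfolding IH rec by (simp add: algebra_simps)
    finally have gj: "(- ?h j + 2 * (?h i + 2 * ?h j * cos t) * cos t) * sin t = f i * D + f j * E" .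
    show ?case
      unfolding step refl_i refl_j x add_diff_cancel_right'
      using gi gj unfolding C_def D_def E_def by (rule conjI)
  qed simp
  then show "g i * sin t = - f i * sin (2 * real d * t - t) - f j * sin (2 * real d * t)"
    and "g j * sin t = f i * sin (2 * real d * t) + f j * sin (2 * real d * t + t)"
    by auto
qed

text \<open>On the coordinates \<open>i\<close> and \<open>j\<close> the \<open>m\<close>-th power
  is a rotation through a full turn; the other coordinates follow because the orthogonal component
  is fixed by both reflections.\<close>

lemma geom_relator:
  assumes "i \<in> I" "j \<in> I" "M i j = enat m" "2 \<le> N"
  shows "foldr (geom_refl N) (alt_word (2 * m) i j) f = f"
proof (cases "i = j")
  case True
  then have "m = 1" using assms matrix_diag by simp
  then show ?thesis using True assms by (simp add: geom_refl_invol numeral_2_eq_2)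
next
  case False
  define t where "t = pi / real (fin_entry N i j)"
  define c where "c k l = cos (pi / real (fin_entry N k l))" for k l
  have m: "fin_entry N i j = m" using assms by (simp add: fin_entry_def)
  have m2: "2 \<le> m" using fin_entry_ge2[OF assms(1,2) False assms(4)] m by simp
  have "0 < t" "t < pi" using m m2 by (auto simp: t_def field_simps)
  then have s: "sin t > 0" by (rule sin_gt_zero)
  have cij: "c i j = cos t" "c j i = cos t" "c i i = -1" "c j j = -1"
    using assms by (simp_all add: c_def t_def fin_entry_sym fin_entry_diag)
  have ss: "sin t * sin t = 1 - cos t * cos t"
    using sin_cos_squared_add[of t] by (simp add: power2_eq_square)
  \<comment> \<open>The component of \<open>f\<close> orthogonal to the span of \<open>\<alpha>\<^sub>i\<close> and \<open>\<alpha>\<^sub>j\<close>, up to the factor \<open>sin\<^sup>2 t\<close>.\<close>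
  define q where "q f k = f k * (sin t * sin t) +
    ((f i + cos t * f j) * c i k + (f j + cos t * f i) * c j k)" for f :: "'i \<Rightarrow> real" and k
  have "geom_refl N i f = (\<lambda>k. f k + 2 * f i * c i k)"
    "geom_refl N j f = (\<lambda>k. f k + 2 * f j * c j k)" for f
    by (simp_all add: geom_refl_def c_def)
  then have q: "q (geom_refl N i f) k = q f k" "q (geom_refl N j f) k = q f k" for f k
    by (simp_all add: q_def cij ss algebra_simps)
  have "q (foldr (geom_refl N) (alt_word n i j) f) k = q f k \<and>
      q (foldr (geom_refl N) (alt_word n j i) f) k = q f k" for n k
    by (induction n) (simp_all add: q)
  moreover define g where "g = foldr (geom_refl N) (alt_word (2 * m) i j) f"
  ultimately have qg: "q g k = q f k" for k by simp
  have mt: "2 * real m * t = 2 * pi" using m m2 by (simp add: t_def)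
  have "g i * sin t = f i * sin t" "g j * sin t = f j * sin t"
    using foldr_geom_refl_alt_word[OF assms(1,2) False, where N = N and d = m and f = f]
    unfolding g_def[symmetric] t_def[symmetric] mt by (simp_all add: sin_diff sin_add)
  then have "g i = f i" "g j = f j" using s by simp_all
  \<comment> \<open>Together with the coordinates at \<open>i\<close> and \<open>j\<close>, the
    invariant \<open>q\<close> determines all the others.\<close>
  then have "g k * (sin t * sin t) = f k * (sin t * sin t)" for k
    using qg[of k] by (simp add: q_def)
  then show ?thesis
    using s unfolding g_def by (intro ext) simp
qed

lemma geom_word_cong:
  assumes "(xs, ys) \<in> word_cong I (coxeter_rels I M)" "2 \<le> N"
  shows "foldr (geom_refl N) xs f = foldr (geom_refl N) ys f"
  using assms(1)
  by (induction arbitrary: f rule: word_cong.induct)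
    (use assms(2) in \<open>auto simp: coxeter_rels_def concat_replicate_alt_word geom_relator\<close>)

text \<open>The word acts as a rotation through \<open>2 * d * t\<close> with
  \<open>0 < d * t < pi\<close>, which is not the identity.\<close>

lemma elt_alt_word_neq:
  assumes "i \<in> I" "j \<in> I" "i \<noteq> j" "0 < d" "enat d < M i j"
  shows "elt (alt_word (2 * d) i j) \<noteq> elt []"
proof
  assume eq: "elt (alt_word (2 * d) i j) = elt []"
  \<comment> \<open>Chosen so that \<open>d\<close> stays below the entry also when
    \<open>M i j\<close> is infinite, and so that \<open>2 \<le> N\<close>.\<close>
  define N where "N = d + 2"
  define t where "t = pi / real (fin_entry N i j)"
  \<comment> \<open>A test vector with coordinates 1 at \<open>i\<close> and 0 at \<open>j\<close>,
    for which the rotation formulas reduce to single sines.\<close>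
  define f where "f k = (of_bool (k = i) :: real)" for k
  have N: "2 \<le> N" by (simp add: N_def)
  have m2: "2 \<le> fin_entry N i j" using fin_entry_ge2 assms N by blast
  have dm: "d < fin_entry N i j"
    using assms(5) by (auto simp: fin_entry_def N_def split: enat.split)
  have t: "0 < t" "t < pi" using m2 by (auto simp: t_def field_simps)
  have "foldr (geom_refl N) (alt_word (2 * d) i j) f = f"
    using eq geom_word_cong[OF _ N, of "alt_word (2 * d) i j" "[]" f] assms(1,2)
    by (simp add: elt_eq_iff alt_word_subset)
  then have "sin t = - sin (2 * real d * t - t)" "sin (2 * real d * t) = 0"
    using foldr_geom_refl_alt_word[OF assms(1-3), where N = N and d = d and f = f] assms(3)
    unfolding t_def[symmetric] by (simp_all add: f_def)
  then have "sin t * (cos (2 * real d * t) - 1) = 0"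
    by (simp add: sin_diff algebra_simps)
  then have "cos (2 * (real d * t)) = 1"
    using sin_gt_zero[OF t] by (simp add: mult.assoc)
  then have "sin (real d * t) = 0"
    by (simp add: cos_double_sin)
  moreover have "real d * t < pi"
    using dm by (simp add: t_def field_simps)
  ultimately show False
    using sin_gt_zero[of "real d * t"] t assms(4) by simp
qed

text \<open>If prefixing \<open>i\<close> did not lengthen the word, \<open>[i]\<close> would be
  among the reflections counted in \<open>alt_word n j i\<close>; then the product of the two
  generators would have a trivial power with exponent at most \<open>n\<close>, below the entry
  \<open>M i j\<close>.\<close>

lemma reduced_alt_word:
  "i \<in> I \<Longrightarrow> j \<in> I \<Longrightarrow> i \<noteq> j \<Longrightarrow> enat n \<le> M i j \<Longrightarrow> reduced (alt_word n i j)"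
proof (induction n arbitrary: i j)
  case (Suc n)
  have n: "enat n \<le> M i j" by (rule order_trans[OF _ Suc.prems(4)]) simp
  then have red: "reduced (alt_word n j i)"
    using Suc.prems Suc.IH[of j i] matrix_sym[of i j] by simp
  have "\<not> desc i (alt_word n j i)"
  proof
    assume "desc i (alt_word n j i)"
    then have "odd (refl_count (alt_word n j i) [i])"
      using Suc.prems by (intro odd_refl_count_desc) (auto simp: alt_word_subset)
    then have "(\<Sum>a<n. of_bool (elt (alt_word (2 * a + 1) j i) = elt [i]) :: nat) \<noteq> 0"
      using refl_count_alt_word[of j i "[i]" n] Suc.prems(1,2) by (intro notI) simp
    then obtain a where "a \<in> {..<n}"
        "of_bool (elt (alt_word (2 * a + 1) j i) = elt [i]) \<noteq> (0 :: nat)"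
      by (rule sum.not_neutral_contains_not_neutral)
    then have a: "a < n" "elt (alt_word (2 * a + 1) j i) = elt [i]"
      by (simp_all only: lessThan_iff of_bool_eq_0_iff not_not)
    have "elt (i # alt_word (2 * a + 1) j i) = elt [i, i]"
      using a Suc.prems by (subst elt_Cons_cancel) (auto simp: alt_word_subset simp del: alt_word.simps)
    then have "elt (alt_word (2 * Suc a) i j) = elt []"
      using elt_square Suc.prems by simp
    moreover have "enat (Suc a) < M i j"
      using a(1) Suc.prems(4) by (meson Suc_less_eq enat_ord_simps(2) less_le_trans)
    ultimately show False
      using elt_alt_word_neq[of i j "Suc a"] Suc.prems by simp
  qed
  then show ?case
    using reduced_Cons[of i] red Suc.prems by simp
qed (simp add: reduced_def)


section \<open>Matsumoto's theorem and the Hecke monoid\<close>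

text \<open>Every alternating word of length at most \<open>M i j\<close> is reduced and hence
  splits off from \<open>w\<close>; an infinite entry would allow one longer than
  \<open>w\<close>.\<close>

lemma two_desc:
  assumes "i \<in> I" "j \<in> I" "i \<noteq> j" "set w \<subseteq> I" "desc i w" "desc j w"
  obtains m where "M i j = enat m" "len w = m + len (rev (alt_word m i j) @ w)"
proof -
  have *: "len w = n + len (rev (alt_word n i j) @ w)" if "enat n \<le> M i j" for n
    using len_all_desc_reduced[of "{i, j}" w "alt_word n i j"] assms reduced_alt_word[of i j n]
      that set_alt_word[of n i j] by auto
  show ?thesis
  proof (cases "M i j")
    case (enat m)
    then show ?thesis using * that by simp
  next
    case infinity
    then show ?thesis using *[of "Suc (len w)"] by simp
  qed
qed

section \<open>Words in the Hecke monoid\<close>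

lemma hk_eq_iff:
  "set xs \<subseteq> I \<Longrightarrow> set ys \<subseteq> I \<Longrightarrow> hk xs = hk ys \<longleftrightarrow> (xs, ys) \<in> word_cong I (hecke_rels I M)"
  unfolding hecke_elt_def
  by (rule eq_equiv_class_iff[OF equiv_word_cong[OF hecke_rels_lists]]) auto

lemma hk_append:
  "set xs \<subseteq> I \<Longrightarrow> set ys \<subseteq> I \<Longrightarrow> hk (xs @ ys) = hk xs \<otimes>\<^bsub>hecke_monoid I M\<^esub> hk ys"
  unfolding hecke_elt_def hecke_monoid_def
  by (rule presented_monoid_mult[OF hecke_rels_lists, symmetric]) auto

lemma hk_closed: "set xs \<subseteq> I \<Longrightarrow> hk xs \<in> carrier (hecke_monoid I M)"
  unfolding hecke_elt_def hecke_monoid_def by (rule presented_monoid_carrierI) auto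

lemma hk_Nil: "hk [] = \<one>\<^bsub>hecke_monoid I M\<^esub>"
  by (simp add: hecke_elt_def hecke_monoid_def presented_monoid_one)

lemma hk_cong_append:
  "set a \<subseteq> I \<Longrightarrow> set b \<subseteq> I \<Longrightarrow> set c \<subseteq> I \<Longrightarrow> set d \<subseteq> I \<Longrightarrow> hk a = hk b \<Longrightarrow> hk c = hk d \<Longrightarrow>
    hk (a @ c) = hk (b @ d)"
  by (simp add: hk_append)

lemma hk_cong_Cons: "i \<in> I \<Longrightarrow> set a \<subseteq> I \<Longrightarrow> set b \<subseteq> I \<Longrightarrow> hk a = hk b \<Longrightarrow> hk (i # a) = hk (i # b)"
  using hk_cong_append[of "[i]" "[i]" a b] by simp

lemma hk_rel:
  "(xs, ys) \<in> hecke_rels I M \<Longrightarrow> hk xs = hk ys"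
  using subsetD[OF hecke_rels_lists, of "(xs, ys)" I M]
  by (subst hk_eq_iff) (auto intro: word_cong.rel)

lemma hk_idem: "i \<in> I \<Longrightarrow> hk [i, i] = hk [i]"
  by (rule hk_rel) (auto simp: hecke_rels_def)

lemma hk_braid: "i \<in> I \<Longrightarrow> j \<in> I \<Longrightarrow> i \<noteq> j \<Longrightarrow> M i j = enat m \<Longrightarrow> hk (alt_word m i j) = hk (alt_word m j i)"
  by (rule hk_rel) (auto simp: hecke_rels_def)

text \<open>Induction on the length. Equal first letters cancel. For different first letters
  \<open>i\<close> and \<open>j\<close> the element has expressions starting with both alternating
  words of length \<open>m\<close>; each shares its first letter with one of the given words, and a
  single braid relation links the two.\<close>

lemma matsumoto:
  "reduced xs \<Longrightarrow> reduced ys \<Longrightarrow> elt xs = elt ys \<Longrightarrow> hk xs = hk ys"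
proof (induction "length xs" arbitrary: xs ys rule: less_induct)
  case less
  have len: "length xs = length ys" using less.prems(1,2) len_cong[OF less.prems(3)] by (simp add: reduced_def)
  note I = reducedD(1)[OF less.prems(1)] reducedD(1)[OF less.prems(2)]
  show ?case
  proof (cases xs)
    case Nil
    then show ?thesis using len by simp
  next
    case xs: (Cons i xs')
    with len obtain j ys' where ys: "ys = j # ys'" by (cases ys) auto
    have red: "reduced xs'" "reduced ys'" using less.prems xs ys reduced_ConsD by auto
    have ij: "i \<in> I" "j \<in> I" and I': "set xs' \<subseteq> I" "set ys' \<subseteq> I" using I xs ys by auto
    show ?thesis
    proof (cases "i = j")
      case True
      then have "elt xs' = elt ys'" using less.prems(3) xs ys ij I' elt_Cons_cancel[of i xs' ys'] by simp
      then have "hk xs' = hk ys'" using red xs by (intro less.hyps) auto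
      then show ?thesis using True xs ys ij I' hk_cong_Cons[of i xs' ys'] by simp
    next
      case False
      have di: "desc i xs" using desc_Cons less.prems(1) xs by simp
      have "desc j ys" using desc_Cons less.prems(2) ys by simp
      then have dj: "desc j xs" using less.prems(3) I ij desc_cong by blast
      obtain m where m: "M i j = enat m" "len xs = m + len (rev (alt_word m i j) @ xs)"
        using two_desc[OF ij False I(1) di dj] by metis
      have aI: "set (alt_word n i j) \<subseteq> I" "set (alt_word n j i) \<subseteq> I" for n
        by (simp_all add: ij alt_word_subset)
      obtain z where z: "reduced z" "elt z = elt (rev (alt_word m i j) @ xs)"
          "length z = len (rev (alt_word m i j) @ xs)"
        using ex_reduced[of "rev (alt_word m i j) @ xs"] aI I by auto
      note zI = reducedD(1)[OF z(1)]
      have e1: "elt (alt_word m i j @ z) = elt xs"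
        using z(2) aI I zI by (simp add: elt_move_left)
      have e2: "elt (alt_word m j i @ z) = elt xs"
        using e1 elt_cong_append[of "alt_word m j i" "alt_word m i j" z z] aI I zI
          elt_braid[OF ij m(1)] by simp
      have r: "reduced (alt_word m i j @ z)" "reduced (alt_word m j i @ z)"
        using len_cong[OF e1] len_cong[OF e2] m(2) z(3) aI zI by (auto simp: reduced_def)
      have "2 \<le> m" using matrix_ge2[OF ij False] m(1) by (simp add: numeral_eq_enat)
      then obtain m' where m': "m = Suc m'" by (cases m) auto
      have "elt xs' = elt (alt_word m' j i @ z)"
        using e1 xs m' ij I' aI zI elt_Cons_cancel[of i "alt_word m' j i @ z" xs'] by simp
      then have "hk xs' = hk (alt_word m' j i @ z)"
        using red r(1) m' xs reduced_ConsD by (intro less.hyps) auto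
      then have 1: "hk xs = hk (alt_word m i j @ z)"
        using xs m' ij I' aI zI hk_cong_Cons[of i xs' "alt_word m' j i @ z"] by simp
      have "elt ys' = elt (alt_word m' i j @ z)"
        using e2 less.prems(3) ys m' ij I' aI zI elt_Cons_cancel[of j "alt_word m' i j @ z" ys'] by simp
      then have "hk ys' = hk (alt_word m' i j @ z)"
        using red r(2) m' xs ys len reduced_ConsD by (intro less.hyps) auto
      then have 2: "hk ys = hk (alt_word m j i @ z)"
        using ys m' ij I' aI zI hk_cong_Cons[of j ys' "alt_word m' i j @ z"] by simp
      have "hk (alt_word m i j @ z) = hk (alt_word m j i @ z)"
        using hk_braid[OF ij False m(1)] aI zI by (intro hk_cong_append) auto
      then show ?thesis using 1 2 by simp
    qed
  qed
qed

text \<open>The action of the Hecke monoid on the Coxeter group by left multiplication separates the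
  classes of reduced words.\<close>

definition hecke_step :: "'i \<Rightarrow> 'i list \<Rightarrow> 'i list" where
  "hecke_step i w = (if desc i w then w else i # w)"

definition hecke_act :: "'i list \<Rightarrow> 'i list \<Rightarrow> 'i list" where
  "hecke_act xs w = foldr hecke_step xs w"

lemma hecke_act_simps [simp]:
  "hecke_act [] w = w"
  "hecke_act (i # xs) w = hecke_step i (hecke_act xs w)"
  "hecke_act (xs @ ys) w = hecke_act xs (hecke_act ys w)"
  by (simp_all add: hecke_act_def)

lemma hecke_act_coset: "\<exists>u. set u \<subseteq> set xs \<and> hecke_act xs w = u @ w"
proof (induction xs)
  case (Cons x xs)
  then obtain u where "set u \<subseteq> set xs" "hecke_act xs w = u @ w" by blast
  then show ?case
    by (cases "desc x (u @ w)")
      (auto simp: hecke_step_def intro: exI[of _ u] exI[of _ "x # u"])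
qed simp

lemma hecke_act_subset: "set xs \<subseteq> I \<Longrightarrow> set w \<subseteq> I \<Longrightarrow> set (hecke_act xs w) \<subseteq> I"
  using hecke_act_coset[of xs w] by fastforce

lemma hecke_act_cong:
  "set xs \<subseteq> I \<Longrightarrow> set w \<subseteq> I \<Longrightarrow> set w' \<subseteq> I \<Longrightarrow> elt w = elt w' \<Longrightarrow>
    elt (hecke_act xs w) = elt (hecke_act xs w')"
proof (induction xs)
  case (Cons x xs)
  then show ?case
    using hecke_act_subset[of xs w] hecke_act_subset[of xs w']
      desc_cong[of "hecke_act xs w" "hecke_act xs w'" x]
    by (auto simp: hecke_step_def elt_Cons_cancel)
qed simp

lemma desc_hecke_step: "i \<in> I \<Longrightarrow> set w \<subseteq> I \<Longrightarrow> desc i (hecke_step i w)"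
  using len_not_desc[of i w] len_cong[OF elt_Cons_Cons, of i w] by (auto simp: hecke_step_def desc_def)

text \<open>Once both letters are descents, further letters change nothing. Until then the result
  starts with the full alternating word, with additive lengths.\<close>

lemma hecke_act_alt_word:
  assumes "set w \<subseteq> I"
  shows "i \<in> I \<Longrightarrow> j \<in> I \<Longrightarrow>
    desc i (hecke_act (alt_word n i j) w) \<and> desc j (hecke_act (alt_word n i j) w) \<or>
    (\<exists>w'. set w' \<subseteq> I \<and> elt (hecke_act (alt_word n i j) w) = elt (alt_word n i j @ w') \<and>
      len (hecke_act (alt_word n i j) w) = n + len w')"
proof (induction n arbitrary: i j)
  case 0
  then show ?case using assms by auto
next
  case (Suc n)
  let ?y = "hecke_act (alt_word n j i) w"
  have aI: "set (alt_word n j i) \<subseteq> I" for n by (simp_all add: Suc.prems alt_word_subset)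
  have yI: "set ?y \<subseteq> I" using aI assms hecke_act_subset by blast
  show ?case
  proof (cases "desc i ?y \<and> desc j ?y")
    case True
    then show ?thesis by (simp add: hecke_step_def)
  next
    case False
    then obtain w' where w': "set w' \<subseteq> I" "elt ?y = elt (alt_word n j i @ w')" "len ?y = n + len w'"
      using Suc.IH[of j i] Suc.prems by blast
    show ?thesis
    proof (cases "desc i ?y")
      case d: False
      have "elt (i # ?y) = elt (i # alt_word n j i @ w')"
        using Suc.prems w' aI yI by (simp add: elt_Cons_cancel)
      then show ?thesis
        using d w' len_not_desc[OF Suc.prems(1) yI d] by (auto simp: hecke_step_def)
    next
      case d: True
      show ?thesis
      proof (cases n)
        case 0
        \<comment> \<open>The first letter to act is already a descent, so it is taken out of
          \<open>w\<close> itself: \<open>i # w\<close> serves as \<open>w'\<close>.\<close>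
        have "elt w = elt (i # i # w)" "len w = Suc (len (i # w))"
          using elt_Cons_Cons[of i w] Suc.prems assms len_desc[of i w] d 0 by auto
        then show ?thesis
          using 0 d Suc.prems assms by (auto simp: hecke_step_def intro!: exI[of _ "i # w"])
      next
        case n: (Suc n')
        \<comment> \<open>The result has an expression of additive length that starts with
          \<open>j\<close>, so \<open>j\<close> is a descent along with \<open>i\<close>, which is
          excluded here.\<close>
        have "elt (j # ?y) = elt (j # alt_word n j i @ w')"
          using Suc.prems w' aI yI by (simp add: elt_Cons_cancel)
        also have "\<dots> = elt (alt_word n' i j @ w')"
          using n w' Suc.prems alt_word_subset[of i I j n'] by (auto intro!: elt_Cons_Cons)
        finally have "len (j # ?y) = len (alt_word n' i j @ w')"
          by (rule len_cong)
        also have "\<dots> \<le> n' + len w'"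
          using len_append[of "alt_word n' i j" w'] len_le[of "alt_word n' i j"] w'
            alt_word_subset[of i I j n'] Suc.prems by auto
        finally have "desc j ?y" using w' n by (simp add: desc_def)
        then show ?thesis using False d by simp
      qed
    qed
  qed
qed

text \<open>After \<open>m\<close> letters the braid relation lets the expression of additive length
  start with either letter, so both are descents in the second alternative as well.\<close>

lemma desc_hecke_act_alt_word:
  assumes "set w \<subseteq> I" "i \<in> I" "j \<in> I" "i \<noteq> j" "M i j = enat m"
  shows "desc i (hecke_act (alt_word m i j) w) \<and> desc j (hecke_act (alt_word m i j) w)"
proof -
  let ?y = "hecke_act (alt_word m i j) w"
  have aI: "set (alt_word n j i) \<subseteq> I" "set (alt_word n i j) \<subseteq> I" for n
    by (simp_all add: assms alt_word_subset)
  have yI: "set ?y \<subseteq> I" using aI assms hecke_act_subset by blast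
  have "2 \<le> m" using matrix_ge2[OF assms(2-4)] assms(5) by (simp add: numeral_eq_enat)
  then obtain m' where m': "m = Suc m'" by (cases m) auto
  have "desc i ?y \<and> desc j ?y" if w': "set w' \<subseteq> I" "elt ?y = elt (alt_word m i j @ w')"
    "len ?y = m + len w'" for w'
  proof -
    have d: "desc k ?y" if "k \<in> {i, j}" "elt ?y = elt (k # u @ w')" "length u = m'" "set u \<subseteq> I" for k u
    proof -
      have k: "k \<in> I" using that assms by auto
      have "elt (k # ?y) = elt (u @ w')"
        using that w' k yI by (subst elt_Cons_move) auto
      then have "len (k # ?y) \<le> m' + len w'"
        using len_cong[of "k # ?y" "u @ w'"] len_append[of u w'] len_le[of u] that w' by simp
      then show ?thesis using w' m' by (simp add: desc_def)
    qed
    have "elt ?y = elt (alt_word m j i @ w')"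
      using w' elt_cong_append[of "alt_word m j i" "alt_word m i j" w' w'] aI
        elt_braid[OF assms(2,3,5)] by simp
    then show ?thesis
      using d[of i "alt_word m' j i"] d[of j "alt_word m' i j"] w' m' aI by simp
  qed
  then show ?thesis
    using hecke_act_alt_word[OF assms(1-3), of m] by blast
qed

text \<open>Both results lie in the coset of \<open>w\<close> under the two generators and have both
  as descents; such an element is unique.\<close>

lemma hecke_act_braid:
  assumes "set w \<subseteq> I" "i \<in> I" "j \<in> I" "i \<noteq> j" "M i j = enat m"
  shows "elt (hecke_act (alt_word m i j) w) = elt (hecke_act (alt_word m j i) w)"
proof -
  obtain u where u: "set u \<subseteq> {i, j}" "hecke_act (alt_word m i j) w = u @ w"
    using hecke_act_coset[of "alt_word m i j" w] set_alt_word[of m i j] by blast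
  obtain v where v: "set v \<subseteq> {i, j}" "hecke_act (alt_word m j i) w = v @ w"
    using hecke_act_coset[of "alt_word m j i" w] set_alt_word[of m j i] by blast
  have "M j i = enat m" using matrix_sym assms by simp
  then have "desc k (u @ w)" "desc k (v @ w)" if "k \<in> {i, j}" for k
    using that desc_hecke_act_alt_word[OF assms] desc_hecke_act_alt_word[of w j i m] assms u v by auto
  then show ?thesis
    unfolding u v using assms u v by (intro all_desc_unique[of "{i, j}"]) auto
qed

lemma hecke_act_word_cong:
  assumes "(xs, ys) \<in> word_cong I (hecke_rels I M)"
  shows "\<forall>w. set w \<subseteq> I \<longrightarrow> elt (hecke_act xs w) = elt (hecke_act ys w)"
  using assms
proof (induction rule: word_cong.induct)
  case (rel xs ys)
  then consider i where "i \<in> I" "xs = [i, i]" "ys = [i]"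
    | i j m where "i \<in> I" "j \<in> I" "i \<noteq> j" "M i j = enat m" "xs = alt_word m i j" "ys = alt_word m j i"
    by (auto simp: hecke_rels_def)
  then show ?case
  proof cases
    case 1
    have "hecke_step i (hecke_step i w) = hecke_step i w" if "set w \<subseteq> I" for w
      using desc_hecke_step[OF 1(1) that] by (simp add: hecke_step_def[of i "hecke_step i w"])
    then show ?thesis using 1 by simp
  next
    case 2
    then show ?thesis using hecke_act_braid by blast
  qed
next
  case (append xs ys us vs)
  have "set xs \<subseteq> I" "set ys \<subseteq> I" "set us \<subseteq> I" "set vs \<subseteq> I"
    using append.hyps word_cong_in_lists[OF hecke_rels_lists] by fastforce+
  then show ?case
    using append.IH hecke_act_subset by (metis hecke_act_cong hecke_act_simps(3))
qed auto

lemma hecke_act_reduced: "reduced xs \<Longrightarrow> hecke_act xs [] = xs"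
proof (induction xs)
  case (Cons x xs)
  have "\<not> desc x xs"
    using Cons.prems reduced_ConsD[OF Cons.prems] by (simp add: desc_def reduced_def)
  then show ?case
    using Cons.IH reduced_ConsD[OF Cons.prems] by (simp add: hecke_step_def)
qed simp

text \<open>The element of a reduced word is recovered from its Hecke class by acting on the
  identity.\<close>

lemma hk_reduced_eqD:
  assumes "reduced xs" "reduced ys" "hk xs = hk ys"
  shows "elt xs = elt ys"
  using assms hecke_act_word_cong[of xs ys, THEN spec, of "[]"] hecke_act_reduced
  by (simp add: hk_eq_iff reduced_def)

text \<open>By Matsumoto's theorem the reduced word may be taken to start with \<open>i\<close>, and
  the doubled letter collapses.\<close>

lemma hk_Cons_desc:
  assumes "reduced ys" "i \<in> I" "desc i ys"
  shows "hk (i # ys) = hk ys"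
proof -
  note ysI = reducedD(1)[OF assms(1)]
  obtain zs where zs: "reduced zs" "elt zs = elt (i # ys)" "length zs = len (i # ys)"
    using ex_reduced[of "i # ys"] ysI assms(2) by auto
  note zsI = reducedD(1)[OF zs(1)]
  have e: "elt (i # zs) = elt ys" using zs ysI zsI assms(2) by (simp add: elt_Cons_move)
  then have "reduced (i # zs)"
    using zs zsI assms(2) len_desc[OF assms(2) ysI assms(3)] len_cong[OF e] by (simp add: reduced_def)
  then have ys: "hk ys = hk (i # zs)" using assms(1) e matsumoto by metis
  then have "hk (i # ys) = hk ([i, i] @ zs)"
    using hk_cong_Cons[of i ys "i # zs"] assms(2) ysI zsI by simp
  also have "\<dots> = hk ([i] @ zs)"
    using hk_idem assms(2) zsI by (intro hk_cong_append) auto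
  finally show ?thesis using ys by simp
qed

lemma hk_Cons_eqD:
  assumes "reduced ys" "i \<in> I" "hk (i # ys) = hk ys"
  shows "desc i ys"
proof (rule ccontr)
  assume d: "\<not> desc i ys"
  then have "reduced (i # ys)" using assms reduced_Cons by simp
  then have "elt (i # ys) = elt ys" using assms hk_reduced_eqD by blast
  then have "len (i # ys) = len ys" by (rule len_cong)
  then show False using len_Cons_neq reducedD(1)[OF assms(1)] assms(2) by blast
qed

text \<open>Unlike in the group, a descent is absorbed without deleting a letter.\<close>

lemma hk_reduced_subset:
  assumes "K \<subseteq> I" "set xs \<subseteq> K"
  obtains ys where "reduced ys" "set ys \<subseteq> K" "hk ys = hk xs"
proof -
  have "\<exists>ys. reduced ys \<and> set ys \<subseteq> K \<and> hk ys = hk xs"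
    using assms(2)
  proof (induction xs)
    case Nil
    then show ?case by (auto simp: reduced_def intro!: exI[of _ "[]"])
  next
    case (Cons x xs)
    then obtain ys where ys: "reduced ys" "set ys \<subseteq> K" "hk ys = hk xs" by auto
    have x: "x \<in> I" "x \<in> K" and xsI: "set xs \<subseteq> I" "set ys \<subseteq> I" using Cons.prems assms ys by auto
    have eq: "hk (x # ys) = hk (x # xs)"
      using x xsI ys by (intro hk_cong_Cons) auto
    show ?case
    proof (cases "desc x ys")
      case True
      then show ?thesis using hk_Cons_desc[OF ys(1) x(1)] ys eq by (intro exI[of _ ys]) auto
    next
      case False
      then show ?thesis using reduced_Cons[OF x(1) ys(1)] ys eq x by (intro exI[of _ "x # ys"]) auto
    qed
  qed
  then show ?thesis using that by blast
qed

lemma cox_to_hecke_elt: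
  assumes "reduced xs"
  shows "cox_to_hecke I M (elt xs) = hk xs"
proof -
  have "reduced_word I M (elt xs) xs"
    using assms by (auto simp: reduced_word_def reduced_def len_def)
  then have "reduced_word I M (elt xs) (SOME ys. reduced_word I M (elt xs) ys)"
    by (rule someI)
  moreover define ys where "ys = (SOME ys. reduced_word I M (elt xs) ys)"
  ultimately have ys: "elt ys = elt xs" "reduced ys"
    by (auto simp: reduced_word_def reduced_def len_def)
  then show ?thesis
    using matsumoto[OF ys(2) assms] by (simp add: cox_to_hecke_def ys_def)
qed


section \<open>Longest and parabolic elements\<close>

lemma parabolic_subgroup_eq:
  assumes "K \<subseteq> I"
  shows "parabolic_subgroup I M K = elt ` {xs. set xs \<subseteq> K}"
proof
  show "parabolic_subgroup I M K \<subseteq> elt ` {xs. set xs \<subseteq> K}"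
  proof
    fix w
    assume "w \<in> parabolic_subgroup I M K"
    then have "w \<in> generate (coxeter_group I M) ((\<lambda>k. elt [k]) ` K)"
      by (simp add: parabolic_subgroup_def)
    then have "\<exists>xs. set xs \<subseteq> K \<and> w = elt xs"
    proof (induction rule: generate.induct)
      case one
      show ?case by (rule exI[of _ "[]"]) (simp add: elt_Nil)
    next
      case (incl h)
      then obtain k where "k \<in> K" "h = elt [k]" by blast
      then show ?case by (intro exI[of _ "[k]"]) simp
    next
      case (inv h)
      then obtain k where "k \<in> K" "h = elt [k]" by blast
      then show ?case
        using assms elt_rev[of "[k]"] by (intro exI[of _ "[k]"]) auto
    next
      case (eng h1 h2)
      then obtain xs ys where "set xs \<subseteq> K" "h1 = elt xs" "set ys \<subseteq> K" "h2 = elt ys" by blast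
      then show ?case
        using assms by (intro exI[of _ "xs @ ys"]) (simp add: elt_append)
    qed
    then show "w \<in> elt ` {xs. set xs \<subseteq> K}" by blast
  qed
next
  have "set xs \<subseteq> K \<Longrightarrow> elt xs \<in> generate (coxeter_group I M) ((\<lambda>k. elt [k]) ` K)" for xs
  proof (induction xs)
    case Nil
    show ?case by (simp add: elt_Nil generate.one)
  next
    case (Cons x xs)
    then have "elt [x] \<in> generate (coxeter_group I M) ((\<lambda>k. elt [k]) ` K)"
      by (intro generate.incl) simp
    moreover have "elt (x # xs) = elt [x] \<otimes>\<^bsub>coxeter_group I M\<^esub> elt xs"
      using elt_append[of "[x]" xs] Cons.prems assms by auto
    ultimately show ?case using Cons by (simp add: generate.eng)
  qed
  then show "elt ` {xs. set xs \<subseteq> K} \<subseteq> parabolic_subgroup I M K"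
    unfolding parabolic_subgroup_def by blast
qed

text \<open>Every element has a reduced word over the finite alphabet \<open>K\<close>, and by
  \<open>len_longest\<close> its length is at most \<open>len v\<close>.\<close>

lemma finite_parabolic_subgroup:
  assumes "K \<subseteq> I" "is_longest K v"
  shows "finite (parabolic_subgroup I M K)"
proof (rule finite_subset)
  show "parabolic_subgroup I M K \<subseteq> elt ` {xs. set xs \<subseteq> K \<and> length xs \<le> len v}"
  proof
    fix w
    assume "w \<in> parabolic_subgroup I M K"
    then obtain xs where xs: "set xs \<subseteq> K" "w = elt xs"
      unfolding parabolic_subgroup_eq[OF assms(1)] by blast
    obtain ys where ys: "reduced ys" "set ys \<subseteq> K" "elt ys = elt xs"
      using reduced_subset[OF assms(1) xs(1)] by blast
    have "length ys \<le> len v"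
      using len_longest[OF assms ys(2)] ys(1) by (simp add: reduced_def)
    then show "w \<in> elt ` {xs. set xs \<subseteq> K \<and> length xs \<le> len v}"
      using ys xs by blast
  qed
  have "finite K" using assms(1) finite_I finite_subset by blast
  then show "finite (elt ` {xs. set xs \<subseteq> K \<and> length xs \<le> len v})"
    by (intro finite_imageI finite_lists_length_le)
qed

lemma ex_longest:
  assumes "K \<subseteq> I" "finite (parabolic_subgroup I M K)"
  obtains v where "is_longest K v" "reduced v" "elt v = longest_elt I M K"
proof -
  let ?P = "parabolic_subgroup I M K"
  have "elt [] \<in> ?P" unfolding parabolic_subgroup_eq[OF assms(1)] by force
  \<comment> \<open>The successor turns the maximum into the strict bound asked for by
    \<open>arg_max_nat_lemma\<close>.\<close>
  moreover have "\<forall>w. w \<in> ?P \<longrightarrow> cox_length I M w < Suc (Max (cox_length I M ` ?P))"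
    using assms(2) by (auto simp: less_Suc_eq_le)
  ultimately have "longest_elt I M K \<in> ?P \<and>
    (\<forall>w. w \<in> ?P \<longrightarrow> cox_length I M w \<le> cox_length I M (longest_elt I M K))"
    unfolding longest_elt_def by (rule arg_max_nat_lemma)
  then have *: "longest_elt I M K \<in> ?P"
    "\<forall>w. w \<in> ?P \<longrightarrow> cox_length I M w \<le> cox_length I M (longest_elt I M K)" by blast+
  then obtain xs where xs: "set xs \<subseteq> K" "longest_elt I M K = elt xs"
    unfolding parabolic_subgroup_eq[OF assms(1)] by blast
  obtain v where v: "reduced v" "set v \<subseteq> K" "elt v = elt xs"
    using reduced_subset[OF assms(1) xs(1)] by blast
  have "desc k v" if "k \<in> K" for k
  proof (rule ccontr)
    assume "\<not> desc k v"
    then have "len (k # v) = Suc (len v)"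
      using that assms(1) v by (intro len_not_desc) auto
    moreover have "elt (k # v) \<in> ?P"
      unfolding parabolic_subgroup_eq[OF assms(1)] using that v by (intro imageI) auto
    ultimately show False
      using *(2)[rule_format, of "elt (k # v)"] xs(2) v(3) by (simp add: len_def)
  qed
  then show ?thesis
    using v xs that[of v] by (simp add: is_longest_def)
qed

lemma longest_elt_eq:
  assumes "K \<subseteq> I" "is_longest K v"
  shows "longest_elt I M K = elt v"
  using ex_longest[OF assms(1) finite_parabolic_subgroup[OF assms]] longest_unique[OF assms(1) _ assms(2)]
  by metis

text \<open>Inversion preserves length, and no element of the parabolic subgroup is longer than
  \<open>v\<close>; so the inverse is longest too, and \<open>v\<close> is an involution.\<close>

lemma elt_rev_longest:
  assumes "K \<subseteq> I" "is_longest K v"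
  shows "elt (rev v) = elt v"
proof (rule longest_unique[OF assms(1) _ assms(2)])
  have v: "set v \<subseteq> K" "set v \<subseteq> I" using assms by (auto simp: is_longest_def)
  have "desc k (rev v)" if "k \<in> K" for k
  proof (rule ccontr)
    assume "\<not> desc k (rev v)"
    then have "len (k # rev v) = Suc (len v)"
      using that assms(1) v len_not_desc[of k "rev v"] by (auto simp: len_rev)
    moreover have "set (k # rev v) \<subseteq> K" using that v by simp
    ultimately show False
      using len_longest[OF assms, of "k # rev v"] by simp
  qed
  then show "is_longest K (rev v)" using v by (simp add: is_longest_def)
qed

text \<open>Two applications of \<open>len_longest\<close> show that \<open>v @ u @ v\<close> has
  length one. Taking a word \<open>u\<close> instead of a letter admits a generator that is only
  known to equal an element of the parabolic subgroup.\<close>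

lemma longest_conj:
  assumes "K \<subseteq> I" "is_longest K v" "set u \<subseteq> K" "len u = 1"
  obtains k where "k \<in> K" "elt (u @ v) = elt (v @ [k])"
proof -
  have v: "set v \<subseteq> K" "set v \<subseteq> I" and u: "set u \<subseteq> I" using assms by (auto simp: is_longest_def)
  have rv: "elt (rev v) = elt v" by (rule elt_rev_longest) fact+
  have "elt (rev u @ rev v) = elt (rev u @ v)"
    using rv u v by (subst elt_cancel_left) auto
  then have "len (v @ u) = len (rev u @ v)"
    using len_rev[of "v @ u"] u v len_cong[of "rev u @ rev v" "rev u @ v"] by simp
  moreover have "len (rev u @ v) + 1 = len v"
    using len_longest[OF assms(1,2), of "rev u"] assms u by (simp add: len_rev)
  moreover have "len ((v @ u) @ v) + len (v @ u) = len v"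
    using assms v by (intro len_longest[OF assms(1,2)]) auto
  ultimately have one: "len (v @ u @ v) = 1" by simp
  obtain z where z: "reduced z" "set z \<subseteq> K" "elt z = elt (v @ u @ v)"
    using reduced_subset[of K "v @ u @ v"] assms v by auto
  have "length z = 1" using z(1) one len_cong[OF z(3)] by (simp add: reduced_def)
  then obtain k where k: "z = [k]" by (cases z) auto
  have "elt (u @ v) = elt (rev v @ [k])"
    using z k u v assms(1) elt_move_left[of v "u @ v" "[k]"] by auto
  also have "\<dots> = elt (v @ [k])"
    using rv z k v assms(1) by (subst elt_cancel_right) auto
  finally show ?thesis using k z by (intro that[of k]) auto
qed

section \<open>Multiplication of parabolic elements by generators\<close>

lemma parabolic_elt_eq:
  assumes "J \<subseteq> K" "K \<subseteq> I" "is_longest J a" "is_longest K b"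
  shows "parabolic_elt I M J K = elt (a @ b)"
  using assms longest_elt_eq[of J a] longest_elt_eq[of K b]
  by (subst elt_append) (auto simp: parabolic_elt_def is_longest_def)

text \<open>If \<open>k\<close> is not a descent of \<open>w\<close>, comparing lengths against
  \<open>b\<close> shows that it is a descent of \<open>a\<close>. Then its generator lies in the
  parabolic subgroup of \<open>J\<close>, and conjugation by \<open>a\<close> and then by
  \<open>b\<close> carries it to a generator from \<open>K\<close>.\<close>

lemma hecke_mult_parabolic_elt:
  assumes JK: "J \<subseteq> K" "K \<subseteq> I" and ab: "is_longest J a" "is_longest K b"
    and w: "reduced w" "set w \<subseteq> K" "elt w = elt (a @ b)" and k: "k \<in> K"
  shows "hk (k # w) = hk w \<or> (\<exists>k'\<in>K. hk (k # w) = hk (w @ [k']))"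
proof (cases "desc k w")
  case True
  then show ?thesis using hk_Cons_desc w k JK by auto
next
  case False
  have kI: "k \<in> I" and wI: "set w \<subseteq> I" and aK: "set a \<subseteq> J" "set a \<subseteq> K" "set a \<subseteq> I"
    and bI: "set b \<subseteq> K" "set b \<subseteq> I" and JI: "J \<subseteq> I"
    using JK ab w k by (auto simp: is_longest_def)
  have kw: "elt (k # w) = elt (k # a @ b)"
    using kI wI w aK bI by (subst elt_Cons_cancel) auto
  have "len ((k # a) @ b) + len (k # a) = len b"
    using k aK by (intro len_longest[OF JK(2) ab(2)]) auto
  moreover have "len (a @ b) + len a = len b"
    using aK by (intro len_longest[OF JK(2) ab(2)])
  moreover have "len (k # w) = Suc (len w)"
    using len_not_desc[OF kI wI False] .
  ultimately have "desc k a"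
    using len_cong[OF kw] len_cong[OF w(3)] by (simp add: desc_def)
  then obtain us y vs where *: "a = us @ y # vs" "elt (k # a) = elt (us @ vs)"
    using exchange[OF aK(3) kI] by blast
  \<comment> \<open>The exchange in \<open>a\<close> yields an expression over \<open>J\<close> for
    the generator \<open>k\<close>, to which \<open>longest_conj\<close> applies.\<close>
  define u where "u = us @ vs @ rev a"
  have u: "set u \<subseteq> J" "set u \<subseteq> I" using aK * by (auto simp: u_def)
  have ek: "elt [k] = elt u"
    using * aK kI elt_move_right[of a "[k]" "us @ vs"] by (simp add: u_def)
  have "len [k] = 1"
    using len_le[of "[k]"] even_len[of "[k]"] kI by (cases "len [k]") auto
  then have "len u = 1" using len_cong[OF ek] by simp
  then obtain j where j: "j \<in> J" "elt (u @ a) = elt (a @ [j])"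
    using longest_conj[OF JI ab(1) u(1)] by blast
  have "len [j] = 1"
    using len_le[of "[j]"] even_len[of "[j]"] j JI by (cases "len [j]") auto
  then obtain k' where k': "k' \<in> K" "elt ([j] @ b) = elt (b @ [k'])"
    using longest_conj[OF JK(2) ab(2), of "[j]"] j JK(1) by auto
  have jI: "j \<in> I" "k' \<in> I" using j k' JK by auto
  have "elt (k # w) = elt (([k] @ a) @ b)" using kw by simp
  also have "\<dots> = elt ((u @ a) @ b)"
    using ek u aK bI kI by (intro elt_cong_append HOL.refl) auto
  also have "\<dots> = elt ((a @ [j]) @ b)"
    by (rule elt_cong_append) (use j u aK bI jI in simp_all)
  also have "\<dots> = elt (a @ [j] @ b)" by simp
  also have "\<dots> = elt (a @ b @ [k'])"
    using k' aK bI jI by (subst elt_cancel_left) auto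
  also have "\<dots> = elt ((a @ b) @ [k'])" by simp
  also have "\<dots> = elt (w @ [k'])"
    using w wI aK bI jI by (intro elt_cong_append HOL.refl) auto
  finally have eq: "elt (k # w) = elt (w @ [k'])" .
  have red: "reduced (k # w)" by (rule reduced_Cons) fact+
  then have "reduced (w @ [k'])"
    using len_cong[OF eq] wI jI by (simp add: reduced_def)
  then have "hk (k # w) = hk (w @ [k'])" using red eq matsumoto by blast
  then show ?thesis using k'(1) by blast
qed

text \<open>The word \<open>y\<close> is there for finiteness: a reduced word for its Hecke class
  has all of \<open>K\<close> as descents.\<close>

lemma parabolic_elt_of_hecke_mult:
  assumes K: "K \<subseteq> I" and y: "set y \<subseteq> K" "\<And>k. k \<in> K \<Longrightarrow> hk (k # y) = hk y"
    and x: "set x \<subseteq> K"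
    and mult: "\<And>k. k \<in> K \<Longrightarrow> hk (k # x) = hk x \<or> (\<exists>k'\<in>K. hk (k # x) = hk (x @ [k']))"
  shows "finite (parabolic_subgroup I M K) \<and>
    (\<exists>J\<subseteq>K. hk x = cox_to_hecke I M (parabolic_elt I M J K))"
proof -
  have is_longest: "is_longest K z" if z: "reduced z" "set z \<subseteq> K" "\<And>k. k \<in> K \<Longrightarrow> hk (k # z) = hk z" for z
    using z K hk_Cons_eqD unfolding is_longest_def by blast
  obtain z where z: "reduced z" "set z \<subseteq> K" "hk z = hk y"
    using hk_reduced_subset[OF K y(1)] by blast
  have "hk (k # z) = hk z" if k: "k \<in> K" for k
  proof -
    have "hk (k # z) = hk (k # y)" using y(1) k z K by (intro hk_cong_Cons) auto
    then show ?thesis using y(2)[OF k] z(3) by simp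
  qed
  then have "is_longest K z" by (intro is_longest z)
  then have fin: "finite (parabolic_subgroup I M K)"
    by (rule finite_parabolic_subgroup[OF K])
  obtain w where w: "reduced w" "set w \<subseteq> K" "hk w = hk x"
    using hk_reduced_subset[OF K x] by blast
  have xI: "set x \<subseteq> I" "set w \<subseteq> I" using x w K by auto
  have wmult: "hk (k # w) = hk w \<or> (\<exists>k'\<in>K. hk (k # w) = hk (w @ [k']))" if "k \<in> K" for k
  proof -
    have "hk (k # w) = hk (k # x)" using xI w that K by (intro hk_cong_Cons) auto
    moreover have "hk (w @ [k']) = hk (x @ [k'])" if "k' \<in> K" for k'
      using xI w that K by (intro hk_cong_append) auto
    ultimately show ?thesis using mult[OF \<open>k \<in> K\<close>] w(3) by auto
  qed
  \<comment> \<open>Letters of \<open>K\<close> pass from the left of \<open>w\<close> to the right;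
    each is absorbed or replaced by a letter of \<open>K\<close>.\<close>
  have move: "\<exists>v. set v \<subseteq> K \<and> hk (u @ w) = hk (w @ v)" if "set u \<subseteq> K" for u
    using that
  proof (induction u)
    case (Cons k u)
    then obtain v where v: "set v \<subseteq> K" "hk (u @ w) = hk (w @ v)" by auto
    have I: "k \<in> I" "k \<in> K" "set u \<subseteq> I" "set v \<subseteq> I" using Cons.prems v K by auto
    have 1: "hk ((k # u) @ w) = hk ((k # w) @ v)"
      using v I xI hk_cong_Cons[of k "u @ w" "w @ v"] by simp
    from wmult[OF I(2)] obtain r where r: "set r \<subseteq> K" "hk (k # w) = hk (w @ r)"
    proof
      assume "hk (k # w) = hk w"
      then show thesis using that[of "[]"] by simp
    next
      assume "\<exists>k'\<in>K. hk (k # w) = hk (w @ [k'])"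
      then obtain k' where "k' \<in> K" "hk (k # w) = hk (w @ [k'])" by blast
      then show thesis using that[of "[k']"] by simp
    qed
    have "hk ((k # w) @ v) = hk ((w @ r) @ v)"
      using r I xI K by (intro hk_cong_append) auto
    then show ?case
      using 1 r v by (intro exI[of _ "r @ v"]) simp
  qed (auto intro: exI[of _ "[]"])
  define J where "J = {k \<in> K. \<not> desc k w}"
  have JK: "J \<subseteq> K" and JI: "J \<subseteq> I" using K by (auto simp: J_def)
  have "parabolic_subgroup I M J \<subseteq> parabolic_subgroup I M K"
    unfolding parabolic_subgroup_eq[OF K] parabolic_subgroup_eq[OF JI] using JK by blast
  then have "finite (parabolic_subgroup I M J)" using fin by (rule finite_subset)
  then obtain a where a: "is_longest J a" "reduced a" using ex_longest[OF JI] by metis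
  have aK: "set a \<subseteq> J" "set a \<subseteq> K" "set a \<subseteq> I" using a(1) JK JI by (auto simp: is_longest_def)
  \<comment> \<open>No letter of \<open>J\<close> is a descent of \<open>w\<close>, so lengths add,
    and the Hecke product of \<open>a\<close> and \<open>w\<close> is also their product in the
    group.\<close>
  have aw: "reduced (a @ w)"
    using len_append_no_desc[OF JI xI(2) _ a(2) aK(1)] w(1) aK(3) xI(2)
    by (simp add: reduced_def J_def)
  obtain v where v: "set v \<subseteq> K" "hk (a @ w) = hk (w @ v)"
    using move[OF aK(2)] by blast
  have vI: "set v \<subseteq> I" using v K by auto
  \<comment> \<open>Letters of \<open>J\<close> are absorbed by \<open>a\<close>; the others are
    descents of \<open>w\<close> and are absorbed in the form \<open>w @ v\<close>.\<close>
  have "hk (k # a @ w) = hk (a @ w)" if k: "k \<in> K" for k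
  proof (cases "desc k w")
    case False
    then have "k \<in> J" using k by (simp add: J_def)
    then have "hk (k # a) = hk a" using a JI hk_Cons_desc by (auto simp: is_longest_def)
    then have "hk ((k # a) @ w) = hk (a @ w)"
      using aK xI k K by (intro hk_cong_append) auto
    then show ?thesis by simp
  next
    case True
    then have "hk (k # w) = hk w" using w(1) k K hk_Cons_desc by auto
    then have "hk ((k # w) @ v) = hk (w @ v)"
      using vI xI k K by (intro hk_cong_append) auto
    moreover have "hk (k # a @ w) = hk (k # w @ v)"
      using v aK xI vI k K by (intro hk_cong_Cons) auto
    ultimately show ?thesis using v by simp
  qed
  then have longest_aw: "is_longest K (a @ w)"
    using aw aK w by (intro is_longest) auto
  \<comment> \<open>As \<open>a\<close> is an involution, \<open>w\<close> is the product of
    \<open>a\<close> and the longest element \<open>a @ w\<close>.\<close>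
  have "elt w = elt (rev a @ a @ w)" using elt_rev_cancel aK xI by simp
  also have "\<dots> = elt (a @ a @ w)"
    using elt_rev_longest[OF JI a(1)] aK xI by (intro elt_cong_append) auto
  also have "\<dots> = parabolic_elt I M J K"
    using parabolic_elt_eq[OF JK K a(1) longest_aw] by simp
  finally have "hk x = cox_to_hecke I M (parabolic_elt I M J K)"
    using cox_to_hecke_elt[OF w(1)] w(3) by simp
  then show ?thesis using fin JK by blast
qed

end

section \<open>Images of parabolic elements under light homomorphisms\<close>

theorem theorem1p1:
  fixes I :: "'a set" and M :: "'a \<Rightarrow> 'a \<Rightarrow> enat"
    and I' :: "'b set" and M' :: "'b \<Rightarrow> 'b \<Rightarrow> enat"
    and \<phi> :: "'b list set \<Rightarrow> 'a list set"
  assumes "coxeter_matrix I M" and "coxeter_matrix I' M'"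
    and "light_hom I' M' I M \<phi>"
  shows "\<forall>K' J'. K' \<subseteq> I' \<and> finite (parabolic_subgroup I' M' K') \<and> J' \<subseteq> K' \<longrightarrow>
    (\<exists>K J. K \<subseteq> I \<and> finite (parabolic_subgroup I M K) \<and> J \<subseteq> K \<and>
      \<phi> (cox_to_hecke I' M' (parabolic_elt I' M' J' K')) =
        cox_to_hecke I M (parabolic_elt I M J K))"
proof (intro allI impI)
  fix K' J'
  assume "K' \<subseteq> I' \<and> finite (parabolic_subgroup I' M' K') \<and> J' \<subseteq> K'"
  then have K': "K' \<subseteq> I'" and fin: "finite (parabolic_subgroup I' M' K')" and J': "J' \<subseteq> K'"
    by auto
  interpret C: coxeter I M by unfold_locales (rule assms(1))
  interpret C': coxeter I' M' by unfold_locales (rule assms(2))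
  have J'I: "J' \<subseteq> I'" using J' K' by blast
  \<comment> \<open>Words of length at most one treat both kinds of images alike; the empty word
    stands for the identity.\<close>
  have "\<exists>p. set p \<subseteq> I \<and> length p \<le> 1 \<and> \<phi> (hecke_elt I' M' [i]) = hecke_elt I M p" if "i \<in> I'" for i
  proof -
    consider j where "j \<in> I" "\<phi> (hecke_elt I' M' [i]) = hecke_elt I M [j]"
      | "\<phi> (hecke_elt I' M' [i]) = hecke_elt I M []"
      using assms(3) \<open>i \<in> I'\<close> unfolding light_hom_def C.hk_Nil by blast
    then show ?thesis
    proof cases
      case (1 j)
      then show ?thesis by (intro exI[of _ "[j]"]) simp
    next
      case 2
      then show ?thesis by (intro exI[of _ "[]"]) simp
    qed
  qed
  then obtain p where p: "\<And>i. i \<in> I' \<Longrightarrow> set (p i) \<subseteq> I" "\<And>i. i \<in> I' \<Longrightarrow> length (p i) \<le> 1"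
    "\<And>i. i \<in> I' \<Longrightarrow> \<phi> (hecke_elt I' M' [i]) = hecke_elt I M (p i)"
    by metis
  define q where "q xs = concat (map p xs)" for xs
  define K where "K = (\<Union>i\<in>K'. set (p i))"
  have KI: "K \<subseteq> I" using p(1) K' by (auto simp: K_def)
  have q: "set (q xs) \<subseteq> I" if "set xs \<subseteq> I'" for xs
    using that p(1) by (fastforce simp: q_def)
  have qK: "set (q xs) \<subseteq> K" if "set xs \<subseteq> K'" for xs
    using that by (auto simp: q_def K_def)
  have \<phi>: "\<phi> (hecke_elt I' M' xs) = hecke_elt I M (q xs)" if "set xs \<subseteq> I'" for xs
    using that
  proof (induction xs)
    case Nil
    then show ?case
      using assms(3) by (simp add: light_hom_def q_def C.hk_Nil C'.hk_Nil)
  next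
    case (Cons i xs)
    have "\<phi> \<in> hom (hecke_monoid I' M') (hecke_monoid I M)"
      using assms(3) by (simp add: light_hom_def)
    then have "\<phi> (hecke_elt I' M' ([i] @ xs)) =
        \<phi> (hecke_elt I' M' [i]) \<otimes>\<^bsub>hecke_monoid I M\<^esub> \<phi> (hecke_elt I' M' xs)"
      using Cons.prems C'.hk_closed[of "[i]"] C'.hk_closed[of xs]
      by (subst C'.hk_append) (auto simp: hom_mult)
    also have "\<dots> = hecke_elt I M (p i @ q xs)"
      using Cons p q[of xs] by (subst C.hk_append) auto
    finally show ?case by (simp add: q_def)
  qed
  \<comment> \<open>Images have at most one letter, so every letter of \<open>K\<close> lifts to a
    generator from \<open>K'\<close>, and relations on the source side can be pushed
    forward.\<close>
  have gen: "\<exists>i\<in>K'. p i = [k]" if k: "k \<in> K" for k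
  proof -
    obtain i where i: "i \<in> K'" "k \<in> set (p i)" using k by (auto simp: K_def)
    then have "p i = [k]"
      using p(2)[of i] K' by (cases "p i") auto
    then show ?thesis using i by blast
  qed
  obtain b where b: "C'.is_longest K' b" "C'.reduced b"
    using C'.ex_longest[OF K' fin] by metis
  have "parabolic_subgroup I' M' J' \<subseteq> parabolic_subgroup I' M' K'"
    unfolding C'.parabolic_subgroup_eq[OF K'] C'.parabolic_subgroup_eq[OF J'I] using J' by blast
  then obtain a where a: "C'.is_longest J' a"
    using C'.ex_longest[OF J'I] fin finite_subset by metis
  have sub: "set a \<subseteq> K'" "set b \<subseteq> K'" using a b J' by (auto simp: C'.is_longest_def)
  obtain w where w: "C'.reduced w" "set w \<subseteq> K'" "cox_elt I' M' w = cox_elt I' M' (a @ b)"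
    using C'.reduced_subset[OF K', of "a @ b"] sub by auto
  have wI: "set w \<subseteq> I'" "set b \<subseteq> I'" using w sub K' by auto
  \<comment> \<open>A lift of \<open>k\<close> is absorbed by the longest element \<open>b\<close>,
    hence \<open>k\<close> by its image; this supplies the word \<open>y\<close> of
    \<open>parabolic_elt_of_hecke_mult\<close>.\<close>
  have qb: "hecke_elt I M (k # q b) = hecke_elt I M (q b)" if "k \<in> K" for k
  proof -
    obtain i where i: "i \<in> K'" "p i = [k]" using gen \<open>k \<in> K\<close> by blast
    have "hecke_elt I' M' (i # b) = hecke_elt I' M' b"
      using b i K' by (intro C'.hk_Cons_desc) (auto simp: C'.is_longest_def)
    then show ?thesis
      using \<phi>[of "i # b"] \<phi>[of b] i wI K' by (auto simp: q_def)
  qed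
  have qw: "hecke_elt I M (k # q w) = hecke_elt I M (q w) \<or>
      (\<exists>k'\<in>K. hecke_elt I M (k # q w) = hecke_elt I M (q w @ [k']))" if "k \<in> K" for k
  proof -
    obtain i where i: "i \<in> K'" "p i = [k]" using gen \<open>k \<in> K\<close> by blast
    have iI: "i \<in> I'" using i K' by blast
    have iw: "\<phi> (hecke_elt I' M' (i # w)) = hecke_elt I M (k # q w)"
      using \<phi>[of "i # w"] iI wI i by (simp add: q_def)
    from C'.hecke_mult_parabolic_elt[OF J' K' a b(1) w i(1)] show ?thesis
    proof
      assume "hecke_elt I' M' (i # w) = hecke_elt I' M' w"
      then show ?thesis using iw \<phi>[OF wI(1)] by simp
    next
      assume "\<exists>i'\<in>K'. hecke_elt I' M' (i # w) = hecke_elt I' M' (w @ [i'])"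
      then obtain i' where i': "i' \<in> K'" "hecke_elt I' M' (i # w) = hecke_elt I' M' (w @ [i'])"
        by blast
      then have i'I: "i' \<in> I'" using K' by blast
      have eq: "hecke_elt I M (k # q w) = hecke_elt I M (q w @ p i')"
        using iw i'(2) \<phi>[of "w @ [i']"] wI i'I by (simp add: q_def)
      show ?thesis
      proof (cases "p i'")
        \<comment> \<open>The generator on the right is sent to the identity, which leaves the first
          alternative.\<close>
        case Nil
        then show ?thesis using eq by simp
      next
        case (Cons k' ks)
        then have "p i' = [k']" using p(2)[OF i'I] by simp
        moreover have "k' \<in> K" using Cons i'(1) by (force simp: K_def)
        ultimately show ?thesis using eq by auto
      qed
    qed
  qed
  have "\<phi> (cox_to_hecke I' M' (parabolic_elt I' M' J' K')) = hecke_elt I M (q w)"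
    using C'.parabolic_elt_eq[OF J' K' a b(1)] w(3) C'.cox_to_hecke_elt[OF w(1)] \<phi>[OF wI(1)] by simp
  then show "\<exists>K J. K \<subseteq> I \<and> finite (parabolic_subgroup I M K) \<and> J \<subseteq> K \<and>
      \<phi> (cox_to_hecke I' M' (parabolic_elt I' M' J' K')) =
        cox_to_hecke I M (parabolic_elt I M J K)"
    using C.parabolic_elt_of_hecke_mult[OF KI qK[OF sub(2)] qb qK[OF w(2)] qw] KI by auto
qed

end
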